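(* Let $f:\mathbb B\to\mathbb B$ be a slice regular self-mapping of the open unit ball $\mathbb B\subset\mathbb H$ and let $\xi\in\partial\mathbb B$. Suppose that there exists a sequence $\{q_n\}_{n\in\mathbb N}\subset\mathbb B$ converging to $\xi$ as $n\to\infty$, such that the limits $$\alpha:=\lim_{n\to\infty}\frac{1-|f(q_n)|}{1-|q_n|}\qquad\text{and}\qquad \eta:=\lim_{n\to\infty}f(q_n)$$ exist (finitely). Then $\alpha>0$ and the inequality $$\mathrm{Re}\Big(\big(1-f(q)\overline{\eta}\big)^{-\ast}\ast\big(1+f(q)\overline{\eta}\big)\Big)\geq\frac1\alpha\,\mathrm{Re}\Big(\big(1-q\overline{\xi}\big)^{-\ast}\ast\big(1+q\overline{\xi}\big)\Big)\qquad (\mathrm J)$$ holds for all $q\in\mathbb B$ and is strict except for regular Möbius transformations of $\mathbb B$. In particular, when $\xi=1$, the inequality $(\mathrm J)$ (on $\mathbb B$) is equivalent to $$\frac{|\eta-f(q)|^2}{1-|f(q)|^2}\leq\alpha\,\frac{|1-q|^2}{1-|q|^2}\qquad (q\in\mathbb B);$$ in other words, $f(\mathcal S(1,k))\subseteq\mathcal S(\eta,\alpha k)$ for all $k>0$.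
   Context: $\mathbb H$ is the algebra of quaternions, $\mathbb B=\{q\in\mathbb H:|q|<1\}$, and $\mathbb S=\{q\in\mathbb H:q^2=-1\}$. For $I\in\mathbb S$, $\mathbb C_I=\mathbb R\oplus I\mathbb R$. A function $f$ on a domain $\Omega\subseteq\mathbb H$ is slice regular if for every $I\in\mathbb S$ its restriction $f_I$ to $\Omega\cap\mathbb C_I$ has continuous partial derivatives and satisfies $\frac12\left(\frac{\partial}{\partial x}+I\frac{\partial}{\partial y}\right)f_I(x+yI)=0$. On $\mathbb B$, slice regular functions are sums of power series $f(q)=\sum_{n\ge0}q^na_n$ with $a_n\in\mathbb H$. For $f(q)=\sum q^na_n$ and $g(q)=\sum q^nb_n$, the regular product is $f\ast g(q)=\sum_{n\ge0}q^n\big(\sum_{k=0}^na_kb_{n-k}\big)$; the regular conjugate is $f^c(q)=\sum q^n\overline{a_n}$; the symmetrization is $f^s=f\ast f^c=f^c\ast f$; and, for $f\not\equiv0$, the regular reciprocal is $f^{-\ast}(q)=f^s(q)^{-1}f^c(q)$, defined off the zero set of $f^s$. In $(\mathrm J)$ the operations $\ast$ and $-\ast$ are applied to the functions $q\mapsto1\pm f(q)\overline\eta$ and $q\mapsto1\pm q\overline\xi$. A regular Möbius transformation of $\mathbb B$ is a function of the form $q\mapsto(1-q\overline u)^{-\ast}\ast(q-u)v$ with $u\in\mathbb B$, $v\in\partial\mathbb B$. For $p\in\partial\mathbb B$ and $k>0$, $\mathcal S(p,k)=\{q\in\mathbb B:|p-q|^2<k(1-|q|^2)\}$. *)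

theory Defs
  imports "HOL-Analysis.Analysis"
begin

section \<open>The algebra of quaternions\<close>

datatype quat = Quat (qre: real) (qi: real) (qj: real) (qk: real)

lemma quat_eq_iff: "x = y \<longleftrightarrow> qre x = qre y \<and> qi x = qi y \<and> qj x = qj y \<and> qk x = qk y"
  by (cases x; cases y) auto

instantiation quat :: ring_1
begin

definition "0 = Quat 0 0 0 0"
definition "1 = Quat 1 0 0 0"
definition "x + y = Quat (qre x + qre y) (qi x + qi y) (qj x + qj y) (qk x + qk y)"
definition "- x = Quat (- qre x) (- qi x) (- qj x) (- qk x)"
definition "x - y = Quat (qre x - qre y) (qi x - qi y) (qj x - qj y) (qk x - qk y)" for x y :: quat
definition "x * y =
  Quat (qre x * qre y - qi x * qi y - qj x * qj y - qk x * qk y)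
       (qre x * qi y + qi x * qre y + qj x * qk y - qk x * qj y)
       (qre x * qj y - qi x * qk y + qj x * qre y + qk x * qi y)
       (qre x * qk y + qi x * qj y - qj x * qi y + qk x * qre y)"

lemma quat_ring_sel [simp]:
  "qre 0 = 0" "qi 0 = 0" "qj 0 = 0" "qk 0 = 0"
  "qre 1 = 1" "qi 1 = 0" "qj 1 = 0" "qk 1 = 0"
  "qre (x + y) = qre x + qre y" "qi (x + y) = qi x + qi y"
  "qj (x + y) = qj x + qj y" "qk (x + y) = qk x + qk y"
  "qre (- x) = - qre x" "qi (- x) = - qi x" "qj (- x) = - qj x" "qk (- x) = - qk x"
  "qre (x - y) = qre x - qre y" "qi (x - y) = qi x - qi y"
  "qj (x - y) = qj x - qj y" "qk (x - y) = qk x - qk y"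
  "qre (x * y) = qre x * qre y - qi x * qi y - qj x * qj y - qk x * qk y"
  "qi (x * y) = qre x * qi y + qi x * qre y + qj x * qk y - qk x * qj y"
  "qj (x * y) = qre x * qj y - qi x * qk y + qj x * qre y + qk x * qi y"
  "qk (x * y) = qre x * qk y + qi x * qj y - qj x * qi y + qk x * qre y"
  by (simp_all add: zero_quat_def one_quat_def plus_quat_def uminus_quat_def
      minus_quat_def times_quat_def)

instance
  by standard (simp_all add: quat_eq_iff algebra_simps)

end

instantiation quat :: real_vector
begin

definition "r *\<^sub>R x = Quat (r * qre x) (r * qi x) (r * qj x) (r * qk x)" for x :: quat

lemma quat_scaleR_sel [simp]:
  "qre (r *\<^sub>R x) = r * qre x" "qi (r *\<^sub>R x) = r * qi x"
  "qj (r *\<^sub>R x) = r * qj x" "qk (r *\<^sub>R x) = r * qk x"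
  by (simp_all add: scaleR_quat_def)

instance
  by standard (simp_all add: quat_eq_iff algebra_simps)

end

instance quat :: real_algebra_1
  by standard (simp_all add: quat_eq_iff algebra_simps)

instantiation quat :: real_inner
begin

definition "x \<bullet> y = qre x * qre y + qi x * qi y + qj x * qj y + qk x * qk y" for x y :: quat
definition "norm x = sqrt ((qre x)\<^sup>2 + (qi x)\<^sup>2 + (qj x)\<^sup>2 + (qk x)\<^sup>2)"
definition "dist x y = norm (x - y)" for x y :: quat
definition "sgn x = x /\<^sub>R norm x" for x :: quat
definition [code del]:
  "(uniformity :: (quat \<times> quat) filter) = (INF e\<in>{0<..}. principal {(x, y). dist x y < e})"
definition [code del]:
  "open U \<longleftrightarrow> (\<forall>x\<in>U. eventually (\<lambda>(x', y). x' = x \<longrightarrow> y \<in> U) uniformity)" for U :: "quat set"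

instance
proof
  fix x y z :: quat and r :: real
  show "x \<bullet> y = y \<bullet> x" "(x + y) \<bullet> z = x \<bullet> z + y \<bullet> z" "r *\<^sub>R x \<bullet> y = r * (x \<bullet> y)"
    by (simp_all add: inner_quat_def algebra_simps)
  show "0 \<le> x \<bullet> x" "norm x = sqrt (x \<bullet> x)"
    by (simp_all add: inner_quat_def norm_quat_def power2_eq_square)
  show "x \<bullet> x = 0 \<longleftrightarrow> x = 0"
    by (simp add: inner_quat_def quat_eq_iff add_nonneg_eq_0_iff)
qed (simp_all add: dist_quat_def sgn_quat_def uniformity_quat_def open_quat_def)

end

definition qcnj :: "quat \<Rightarrow> quat"
  where "qcnj x = Quat (qre x) (- qi x) (- qj x) (- qk x)"

lemma quat_cnj_sel [simp]:
  "qre (qcnj x) = qre x" "qi (qcnj x) = - qi x" "qj (qcnj x) = - qj x" "qk (qcnj x) = - qk x"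
  by (simp_all add: qcnj_def)

instantiation quat :: real_normed_div_algebra
begin

definition "inverse x = qcnj x /\<^sub>R (norm x)\<^sup>2"
definition "x div y = x * inverse y" for x y :: quat

lemma norm_quat_power2: "(norm x)\<^sup>2 = (qre x)\<^sup>2 + (qi x)\<^sup>2 + (qj x)\<^sup>2 + (qk x)\<^sup>2"
  by (simp add: norm_quat_def)

instance
proof
  fix x y :: quat
  have *: "x * qcnj x = (norm x)\<^sup>2 *\<^sub>R 1" "qcnj x * x = (norm x)\<^sup>2 *\<^sub>R 1"
    unfolding norm_quat_power2 by (simp_all add: quat_eq_iff power2_eq_square)
  show "inverse x * x = 1" "x * inverse x = 1" if "x \<noteq> 0"
    using that unfolding inverse_quat_def mult_scaleR_left mult_scaleR_right * by simp_all
  show "x div y = x * inverse y"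
    by (simp add: divide_quat_def)
  show "inverse (0::quat) = 0"
    by (simp add: inverse_quat_def quat_eq_iff)
  have "(norm (x * y))\<^sup>2 = (norm x * norm y)\<^sup>2"
    unfolding power_mult_distrib norm_quat_power2 quat_ring_sel by algebra
  then show "norm (x * y) = norm x * norm y"
    by simp
qed

end

instantiation quat :: euclidean_space
begin

definition "Basis = {Quat 1 0 0 0, Quat 0 1 0 0, Quat 0 0 1 0, Quat 0 0 0 1}"

instance
proof
  show "(Basis :: quat set) \<noteq> {}" "finite (Basis :: quat set)"
    by (simp_all add: Basis_quat_def)
  show "u \<bullet> v = (if u = v then 1 else 0)" if "u \<in> Basis" "v \<in> Basis" for u v :: quat
    using that unfolding Basis_quat_def by (elim insertE emptyE) (simp_all add: inner_quat_def)
  show "(\<forall>u\<in>Basis. x \<bullet> u = 0) \<longleftrightarrow> x = 0" for x :: quat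
    unfolding Basis_quat_def quat_eq_iff[of x 0] by (simp add: inner_quat_def)
qed

end


section \<open>Slice regular functions\<close>

definition quat_S :: "quat set"
  where "quat_S = {q. q\<^sup>2 = - 1}"

text \<open>
  For \<open>I \<in> quat_S\<close> the restriction of \<open>f\<close> to the slice \<open>\<Omega> \<inter> (\<real> \<oplus> I\<real>)\<close> is read as a function of
  the two real coordinates of \<open>x + yI\<close>; \<open>fx\<close> and \<open>fy\<close> are its partial derivatives.
  The set \<open>\<Omega>\<close> is meant to be open.
\<close>
definition slice_regular_on :: "quat set \<Rightarrow> (quat \<Rightarrow> quat) \<Rightarrow> bool"
  where "slice_regular_on \<Omega> f \<longleftrightarrow>
    (\<forall>I\<in>quat_S. \<exists>fx fy :: real \<times> real \<Rightarrow> quat.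
       let D = {(x, y). of_real x + of_real y * I \<in> \<Omega>} in
         continuous_on D fx \<and> continuous_on D fy \<and>
         (\<forall>(x, y)\<in>D.
            ((\<lambda>t. f (of_real t + of_real y * I)) has_vector_derivative fx (x, y)) (at x) \<and>
            ((\<lambda>t. f (of_real x + of_real t * I)) has_vector_derivative fy (x, y)) (at y) \<and>
            (1/2) *\<^sub>R (fx (x, y) + I * fy (x, y)) = 0))"

text \<open>
  The coefficients of a slice regular function on the unit ball; they are unique when they exist
  (\<open>regular_coeffs_eqI\<close> below). The operations defined from them are meaningful on the unit ball only.
\<close>
definition regular_coeffs :: "(quat \<Rightarrow> quat) \<Rightarrow> nat \<Rightarrow> quat"
  where "regular_coeffs f = (THE a. \<forall>q\<in>ball 0 1. (\<lambda>n. q ^ n * a n) sums f q)"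

lemma powser_real_sums_zero:
  fixes c :: "nat \<Rightarrow> real"
  assumes "\<And>x. x \<noteq> 0 \<Longrightarrow> norm x < 1 \<Longrightarrow> (\<lambda>n. c n * x ^ n) sums 0"
  shows "c m = 0"
  using assms
proof (induction m arbitrary: c)
  case 0
  have "((\<lambda>x::real. 0) \<longlongrightarrow> c 0) (at 0)"
    by (rule powser_limit_0_strong[of 1]) (use 0 in auto)
  then show ?case
    by (simp add: tendsto_const_iff)
next
  case (Suc m)
  have "((\<lambda>x::real. 0) \<longlongrightarrow> c 0) (at 0)"
    by (rule powser_limit_0_strong[of 1]) (use Suc.prems in auto)
  then have c0: "c 0 = 0"
    by (simp add: tendsto_const_iff)
  show ?case
  proof (rule Suc.IH[of "\<lambda>n. c (Suc n)"])
    fix x :: real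
    assume x: "x \<noteq> 0" "norm x < 1"
    have "(\<lambda>n. c (Suc n) * x ^ Suc n) sums 0"
      using Suc.prems[OF x] c0 by (subst sums_Suc_iff) simp
    then have "(\<lambda>n. c (Suc n) * x ^ Suc n / x) sums (0 / x)"
      by (rule sums_divide)
    then show "(\<lambda>n. c (Suc n) * x ^ n) sums 0"
      using x by simp
  qed
qed

lemma regular_coeffs_unique:
  assumes a: "\<And>q. q \<in> ball 0 1 \<Longrightarrow> (\<lambda>n. q ^ n * a n) sums f q"
      and b: "\<And>q. q \<in> ball 0 1 \<Longrightarrow> (\<lambda>n. q ^ n * b n) sums f q"
  shows "a = (b :: nat \<Rightarrow> quat)"
proof -
  have comp: "(\<lambda>n. c n \<bullet> e * r ^ n) sums (f (of_real r) \<bullet> e)"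
    if c: "\<And>q. q \<in> ball 0 1 \<Longrightarrow> (\<lambda>n. q ^ n * c n) sums f q" and "\<bar>r\<bar> < 1"
    for c :: "nat \<Rightarrow> quat" and e :: quat and r :: real
  proof -
    have "(\<lambda>n. (of_real r ^ n * c n) \<bullet> e) sums (f (of_real r) \<bullet> e)"
      using c[of "of_real r"] \<open>\<bar>r\<bar> < 1\<close>
      by (intro bounded_linear.sums[OF bounded_linear_inner_left]) simp
    moreover have "(of_real r ^ n * c n) \<bullet> e = c n \<bullet> e * r ^ n" for n
      by (metis inner_scaleR_left mult.commute of_real_power scaleR_conv_of_real)
    ultimately show ?thesis by simp
  qed
  have "a m \<bullet> e - b m \<bullet> e = 0" for m e
  proof (rule powser_real_sums_zero)
    fix r :: real
    assume "norm r < 1"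
    then show "(\<lambda>n. (a n \<bullet> e - b n \<bullet> e) * r ^ n) sums 0"
      using sums_diff[OF comp[OF a, of r e] comp[OF b, of r e]] by (simp add: left_diff_distrib)
  qed
  then show ?thesis
    by (auto simp: fun_eq_iff euclidean_eq_iff[where 'a = quat])
qed

lemma regular_coeffs_eqI:
  assumes "\<And>q. q \<in> ball 0 1 \<Longrightarrow> (\<lambda>n. q ^ n * a n) sums f q"
  shows "regular_coeffs f = a"
  unfolding regular_coeffs_def
  using assms by (intro the_equality) (auto intro: regular_coeffs_unique)

definition regular_mult :: "(quat \<Rightarrow> quat) \<Rightarrow> (quat \<Rightarrow> quat) \<Rightarrow> quat \<Rightarrow> quat"  (infixl \<open>\<star>\<close> 70)
  where "(f \<star> g) q =
    (\<Sum>n. q ^ n * (\<Sum>k\<le>n. regular_coeffs f k * regular_coeffs g (n - k)))"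

definition regular_conj :: "(quat \<Rightarrow> quat) \<Rightarrow> quat \<Rightarrow> quat"
  where "regular_conj f q = (\<Sum>n. q ^ n * qcnj (regular_coeffs f n))"

definition symmetrization :: "(quat \<Rightarrow> quat) \<Rightarrow> quat \<Rightarrow> quat"
  where "symmetrization f = f \<star> regular_conj f"

definition regular_recip :: "(quat \<Rightarrow> quat) \<Rightarrow> quat \<Rightarrow> quat"
  where "regular_recip f q = inverse (symmetrization f q) * regular_conj f q"

definition regular_cayley :: "(quat \<Rightarrow> quat) \<Rightarrow> quat \<Rightarrow> quat"
  where "regular_cayley g = regular_recip (\<lambda>q. 1 - g q) \<star> (\<lambda>q. 1 + g q)"

definition regular_moebius :: "(quat \<Rightarrow> quat) \<Rightarrow> bool"
  where "regular_moebius f \<longleftrightarrow>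
    (\<exists>u\<in>ball 0 1. \<exists>v\<in>sphere 0 1. \<forall>q\<in>ball 0 1.
       f q = (regular_recip (\<lambda>q. 1 - q * qcnj u) \<star> (\<lambda>q. (q - u) * v)) q)"

definition horoball :: "quat \<Rightarrow> real \<Rightarrow> quat set"
  where "horoball p k = {q \<in> ball 0 1. (norm (p - q))\<^sup>2 < k * (1 - (norm q)\<^sup>2)}"

end

theory Submission
  imports Defs "HOL-Complex_Analysis.Conformal_Mappings" "HOL-Computational_Algebra.Formal_Power_Series"
begin

text \<open>
  The proof takes place in the quaternionic Hardy space of power series
  \<open>\<Sum> q ^ n * a n\<close> with square-summable coefficients, where the regular product is the product of formal
  power series (\<open>quat fps\<close>).

  The analytic core is that a power series bounded by 1 on the ball acts as a contraction
  by multiplication (\<open>toeplitz_contraction\<close>). To see this, the quaternionic variable is replaced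
  by a central complex variable \<open>z = r e\<^sup>i\<^sup>\<theta>\<close>, with values in the complexified quaternions. There the
  regular product is the pointwise product, the norm bound on a whole sphere \<open>x + y J\<close> is precisely an
  operator norm bound at the point \<open>x + i y\<close> (\<open>contractive_on_sphere\<close>, \<open>biquaternion_contraction\<close>), and
  Parseval's identity gives the contraction.

  Let \<open>F(q) = f(q) * qcnj \<eta>\<close> and let \<open>L\<close> be the regular reciprocal of \<open>1 - F\<close>, so that the Cayley transform
  of \<open>F\<close> is \<open>2 L - 1\<close> (\<open>regular_cayley_eq\<close>). The adjoint of multiplication by \<open>F\<close> acts explicitly on the
  evaluation vector of a point \<open>p\<close>, and also on the vector \<open>v\<close> with entries
  \<open>qcnj (q ^ j * L(q))\<close>, which it maps to \<open>v\<close> minus the evaluation vector of \<open>q\<close>. For a contraction \<open>T\<close>, the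
  form of \<open>1 - T T\<^sup>*\<close> satisfies the Cauchy-Schwarz inequality. Written out for these two vectors, it is
  a Pick inequality (\<open>two_point_inequality\<close>) with the factors
  \<open>Re (2 L(q) - 1) / (1 - |q|\<^sup>2)\<close> and \<open>(1 - |f(p)|\<^sup>2) / (1 - |p|\<^sup>2)\<close>. For \<open>p = q\<^sub>n\<close> the second factor tends to
  \<open>\<alpha>\<close>, and the mixed term tends to the Szego kernel at the boundary point \<open>\<xi>\<close>, whose squared norm times
  \<open>1 - |q|\<^sup>2\<close> is the real part of the Cayley transform of \<open>q * qcnj \<xi>\<close>. The limit is the Julia
  inequality. With the evaluation vector of \<open>q\<close> in place of \<open>v\<close>, the same limit gives the horoball inequality for
  \<open>\<xi> = 1\<close>, and at \<open>q = 0\<close> the positivity of \<open>\<alpha>\<close>.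

  The difference of the two sides of the Julia inequality is the real part of a regular function. If it
  vanishes at one point, the open mapping theorem on slices makes that function an
  imaginary constant (\<open>qre_nonneg_zero_constant\<close>), and solving for \<open>F\<close> in the ring of power series shows that \<open>f\<close> is
  a Moebius transformation (\<open>moebius_of_resolvent\<close>). Conversely, for a Moebius transformation the number
  \<open>\<alpha>\<close> can be computed, and equality holds at the origin (\<open>moebius_julia_coefficient\<close>).
\<close>

section \<open>Quaternions and their slices\<close>

lemma qcnj_mult [simp]: "qcnj (x * y) = qcnj y * qcnj x"
  by (simp add: quat_eq_iff algebra_simps)

lemma qcnj_arith [simp]:
  "qcnj 0 = 0" "qcnj 1 = 1" "qcnj (x + y) = qcnj x + qcnj y" "qcnj (x - y) = qcnj x - qcnj y"
  "qcnj (- x) = - qcnj x" "qcnj (r *\<^sub>R x) = r *\<^sub>R qcnj x" "qcnj (qcnj x) = x"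
  "qcnj (of_real r) = of_real r"
  by (simp_all add: quat_eq_iff of_real_def)

lemma qcnj_power [simp]: "qcnj (x ^ n) = qcnj x ^ n"
  by (induction n) (simp_all add: power_commutes)

lemma norm_qcnj [simp]: "norm (qcnj x) = norm x"
  by (simp add: norm_quat_def)

lemma qre_simps [simp]: "qre (of_real r) = r" "qi (of_real r) = 0" "qj (of_real r) = 0" "qk (of_real r) = 0"
  by (simp_all add: of_real_def)

lemma bounded_linear_qcnj: "bounded_linear qcnj"
  by (rule bounded_linear_intro[where K=1]) simp_all

lemma qcnj_sum: "qcnj (sum g A) = (\<Sum>x\<in>A. qcnj (g x))"
  by (rule linear_sum[OF bounded_linear.linear[OF bounded_linear_qcnj]])

lemma bounded_linear_qre: "bounded_linear qre"
proof (rule bounded_linear_intro[where K=1])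
  show "norm (qre x) \<le> norm x * 1" for x
    unfolding norm_quat_def by (simp add: real_le_rsqrt abs_le_square_iff[symmetric] real_sqrt_ge_abs1)
qed simp_all

lemma mult_qcnj: "x * qcnj x = of_real ((norm x)\<^sup>2)" "qcnj x * x = of_real ((norm x)\<^sup>2)"
  unfolding norm_quat_power2 quat_eq_iff qre_simps quat_ring_sel quat_cnj_sel
  by (simp_all add: power2_eq_square)

lemma qre_mult_commute: "qre (x * y) = qre (y * x)"
  by simp

lemma inner_eq_qre: "x \<bullet> y = qre (qcnj x * y)"
  by (simp add: inner_quat_def)

lemma abs_qre_le_norm: "\<bar>qre x\<bar> \<le> norm x"
  using bounded_linear.bounded[OF bounded_linear_qre]
  by (metis norm_quat_def real_sqrt_abs real_sqrt_le_iff add_increasing2 order_refl zero_le_power2)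

lemma norm_add_sq: "(norm (x + y))\<^sup>2 = (norm x)\<^sup>2 + (norm y)\<^sup>2 + 2 * qre (qcnj x * y)" for x y :: quat
  by (simp add: power2_norm_eq_inner inner_add inner_commute[of y x] inner_eq_qre[of x y])

definition qim :: "quat \<Rightarrow> quat" where "qim x = x - of_real (qre x)"

lemma qim_sel [simp]: "qre (qim x) = 0" "qi (qim x) = qi x" "qj (qim x) = qj x" "qk (qim x) = qk x"
  by (simp_all add: qim_def)

lemma quat_S_iff: "I \<in> quat_S \<longleftrightarrow> qre I = 0 \<and> norm I = 1"
proof
  assume "I \<in> quat_S"
  then have *: "I * I = - 1" by (simp add: quat_S_def power2_eq_square)
  then have "norm I * norm I = 1" by (metis norm_minus_cancel norm_mult norm_one)
  then have n: "norm I = 1" by (metis norm_ge_zero power2_eq_1_iff power2_eq_square neg_0_le_iff_le not_one_le_zero)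
  have "(qre I)\<^sup>2 + (qi I)\<^sup>2 + (qj I)\<^sup>2 + (qk I)\<^sup>2 = 1" using n norm_quat_power2[of I] by simp
  moreover have "qre (I*I) = -1" using * by simp
  ultimately have "qre I * qre I = 0" unfolding quat_ring_sel power2_eq_square by linarith
  then show "qre I = 0 \<and> norm I = 1" using n by simp
next
  assume *: "qre I = 0 \<and> norm I = 1"
  then have "(qi I)\<^sup>2 + (qj I)\<^sup>2 + (qk I)\<^sup>2 = 1" using norm_quat_power2[of I] by simp
  then show "I \<in> quat_S"
    using * by (simp add: quat_S_def quat_eq_iff power2_eq_square)
qed

lemma quat_in_slice: "\<exists>I\<in>quat_S. q = of_real (qre q) + of_real (norm (qim q)) * I"
proof (cases "qim q = 0")
  case True
  have "Quat 0 1 0 0 \<in> quat_S" by (simp add: quat_S_iff norm_quat_def)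
  moreover have "q = of_real (qre q)" using True by (simp add: qim_def)
  ultimately show ?thesis using True by auto
next
  case False
  let ?I = "(1 / norm (qim q)) *\<^sub>R qim q"
  have "?I \<in> quat_S" using False by (simp add: quat_S_iff)
  moreover have "of_real (norm (qim q)) * ?I = qim q"
    using False by (simp add: scaleR_conv_of_real mult.assoc[symmetric] flip: of_real_mult)
  ultimately show ?thesis by (metis qim_def add_diff_cancel_left' diff_add_cancel add.commute)
qed

text \<open>
  The points \<open>A + J * B\<close> are the values of a slice regular function on one sphere
  \<open>x + y J\<close>, \<open>J \<in> quat_S\<close>. Since \<open>(norm (A + J * B))\<^sup>2\<close> is an affine function of \<open>J\<close>
  whose linear part is the inner product with \<open>2 * qim (B * qcnj A)\<close>, up to sign, its maximum over
  the sphere is the left-hand side. That number is also the square of the operator norm of left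
  multiplication by \<open>A + i B\<close> on the complexified quaternions.
\<close>
lemma contractive_on_sphere:
  assumes AB: "\<And>J. J \<in> quat_S \<Longrightarrow> norm (A + J * B) \<le> M"
  shows "(norm A)\<^sup>2 + (norm B)\<^sup>2 + 2 * norm (qim (B * qcnj A)) \<le> M\<^sup>2"
proof -
  obtain J where J: "J \<in> quat_S" "qim (B * qcnj A) = of_real (norm (qim (B * qcnj A))) * J"
    using quat_in_slice[of "qim (B * qcnj A)"] 
    by (metis (no_types, lifting) add_0 diff_zero qim_def qim_sel(1) of_real_0)
  let ?n = "norm (qim (B * qcnj A))"
  \<comment> \<open>the unit imaginary quaternion at which the maximum is attained\<close>
  let ?K = "- J"
  have K: "?K \<in> quat_S" using J by (simp add: quat_S_iff)
  have "M\<^sup>2 \<ge> (norm (A + ?K * B))\<^sup>2" using AB[OF K] by (simp add: power_mono)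
  also have "(norm (A + ?K * B))\<^sup>2 = (norm A)\<^sup>2 + (norm B)\<^sup>2 + 2 * qre (qcnj A * (?K * B))"
    using K unfolding norm_add_sq norm_mult quat_S_iff by simp
  also have "qre (qcnj A * (?K * B)) = qre (?K * (B * qcnj A))"
    using qre_mult_commute[of "qcnj A" "?K * B"] by (simp add: mult.assoc del: quat_ring_sel)
  also have "\<dots> = qre (?K * qim (B * qcnj A))"
    using J(1) by (simp add: quat_S_iff del: qcnj_mult)
  also have "\<dots> = ?n"
  proof -
    have "?K * qim (B * qcnj A) = ?K * (?n *\<^sub>R J)"
      using J(2) by (metis scaleR_conv_of_real)
    also have "\<dots> = ?n *\<^sub>R 1"
      using J(1) by (simp add: quat_S_def power2_eq_square del: qcnj_mult)
    finally show ?thesis by (simp only: quat_scaleR_sel quat_ring_sel(5) mult_1_right)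
  qed
  finally show ?thesis by simp
qed

text \<open>
  With a central imaginary unit \<open>i\<close>, this bounds the norm of the product
  \<open>(qcnj A + i * qcnj B) * (C + i * D)\<close> in the complexified quaternions by \<open>M\<close> times the norm of
  the second factor. The conjugates on \<open>A\<close> and \<open>B\<close> turn the cross term into an expression in
  \<open>B * qcnj A\<close>, exactly what the previous lemma controls.
\<close>
lemma biquaternion_contraction:
  assumes AB: "\<And>J. J \<in> quat_S \<Longrightarrow> norm (A + J * B) \<le> M"
  shows "(norm (qcnj A * C - qcnj B * D))\<^sup>2 + (norm (qcnj A * D + qcnj B * C))\<^sup>2
    \<le> M\<^sup>2 * ((norm C)\<^sup>2 + (norm D)\<^sup>2)"
proof -
  let ?X = "B * qcnj A"
  let ?S = "(norm C)\<^sup>2 + (norm D)\<^sup>2"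
  have *: "(norm (qcnj A * C - qcnj B * D))\<^sup>2 + (norm (qcnj A * D + qcnj B * C))\<^sup>2
    = ((norm A)\<^sup>2 + (norm B)\<^sup>2) * ?S + 4 * (qim (qcnj ?X) \<bullet> qim (D * qcnj C))"
    unfolding norm_quat_power2 inner_quat_def qcnj_def by (simp add: power2_eq_square algebra_simps)
  have "qim (qcnj ?X) \<bullet> qim (D * qcnj C) \<le> norm (qim (qcnj ?X)) * norm (qim (D * qcnj C))"
    by (rule norm_cauchy_schwarz)
  also have "norm (qim (qcnj ?X)) = norm (qim ?X)"
    unfolding norm_quat_def by (simp add: power2_eq_square algebra_simps)
  also have "norm (qim (D * qcnj C)) \<le> norm (D * qcnj C)"
    unfolding norm_quat_def by (simp del: quat_ring_sel)
  also have "\<dots> \<le> ?S / 2"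
    using sum_squares_bound[of "norm C" "norm D"] by (simp add: norm_mult algebra_simps)
  finally have "qim (qcnj ?X) \<bullet> qim (D * qcnj C) \<le> norm (qim ?X) * (?S / 2)"
    by (simp add: mult_left_mono)
  then have "(norm (qcnj A * C - qcnj B * D))\<^sup>2 + (norm (qcnj A * D + qcnj B * C))\<^sup>2
    \<le> ((norm A)\<^sup>2 + (norm B)\<^sup>2 + 2 * norm (qim ?X)) * ?S"
    unfolding * by (simp add: algebra_simps del: qcnj_mult)
  also have "\<dots> \<le> M\<^sup>2 * ?S"
    by (intro mult_right_mono contractive_on_sphere AB) auto
  finally show ?thesis .
qed

section \<open>Toeplitz contractions\<close>

definition cosum :: "nat \<Rightarrow> (nat \<Rightarrow> quat) \<Rightarrow> real \<Rightarrow> quat"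
  where "cosum N c \<theta> = (\<Sum>n\<le>N. cos (real n * \<theta>) *\<^sub>R c n)"

definition sinsum :: "nat \<Rightarrow> (nat \<Rightarrow> quat) \<Rightarrow> real \<Rightarrow> quat"
  where "sinsum N c \<theta> = (\<Sum>n\<le>N. sin (real n * \<theta>) *\<^sub>R c n)"

lemma has_integral_cos_diff:
  "((\<lambda>\<theta>. cos ((real m - real n) * \<theta>)) has_integral (if m = n then 2 * pi else 0)) {0..2*pi}"
proof (cases "m = n")
  case True
  then show ?thesis using has_integral_const_real[of "1::real" 0 "2*pi"] by simp
next
  case False
  let ?k = "real m - real n"
  have k: "?k \<noteq> 0" using False by simp
  have "((\<lambda>\<theta>. cos (?k * \<theta>)) has_integral (sin (?k * (2*pi)) / ?k - sin (?k * 0) / ?k)) {0..2*pi}"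
    by (rule fundamental_theorem_of_calculus)
       (auto intro!: derivative_eq_intros simp: False has_real_derivative_iff_has_vector_derivative[symmetric])
  moreover have "sin (?k * (2*pi)) = 0"
    using sin_int_2pin[of "int m - int n"] by (simp add: mult.commute)
  ultimately show ?thesis using False by simp
qed

text \<open>
  Both sums together form the boundary value \<open>\<Sum> e\<^sup>i\<^sup>n\<^sup>\<theta> c n\<close> in the complexified quaternions, and the
  monomials with different exponents are orthogonal over a full period.
\<close>
lemma trig_parseval:
  "((\<lambda>\<theta>. (norm (cosum N c \<theta>))\<^sup>2 + (norm (sinsum N c \<theta>))\<^sup>2) has_integral
     2 * pi * (\<Sum>n\<le>N. (norm (c n))\<^sup>2)) {0..2*pi}"
proof -
  have eq: "(norm (cosum N c \<theta>))\<^sup>2 + (norm (sinsum N c \<theta>))\<^sup>2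
     = (\<Sum>m\<le>N. \<Sum>n\<le>N. cos ((real m - real n) * \<theta>) * (c m \<bullet> c n))" for \<theta>
    unfolding cosum_def sinsum_def power2_norm_eq_inner inner_sum_left inner_sum_right
      sum.distrib[symmetric]
    by (intro sum.cong) (simp_all add: left_diff_distrib cos_diff algebra_simps inner_commute)
  have "((\<lambda>\<theta>. \<Sum>m\<le>N. \<Sum>n\<le>N. cos ((real m - real n) * \<theta>) * (c m \<bullet> c n)) has_integral
     (\<Sum>m\<le>N. \<Sum>n\<le>N. (if m = n then 2 * pi else 0) * (c m \<bullet> c n))) {0..2*pi}"
    by (intro has_integral_sum has_integral_mult_left has_integral_cos_diff finite_atMost)
  moreover have "(\<Sum>n\<le>N. (if m = n then 2 * pi else 0) * (c m \<bullet> c n)) = 2 * pi * (norm (c m))\<^sup>2"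
    if "m \<le> N" for m
    using that by (simp add: if_distrib[of "\<lambda>x. x * _"] power2_norm_eq_inner cong: if_cong)
  ultimately show ?thesis
    unfolding eq by (simp add: sum_distrib_left)
qed

lemma sum_convolution:
  fixes X :: "nat \<Rightarrow> nat \<Rightarrow> 'a :: comm_monoid_add"
  assumes "\<And>k j. k > K \<or> j > N \<Longrightarrow> X k j = 0"
  shows "(\<Sum>n\<le>K+N. \<Sum>k\<le>n. X k (n - k)) = (\<Sum>k\<le>K. \<Sum>j\<le>N. X k j)"
proof -
  have "(\<Sum>n\<le>K+N. \<Sum>k\<le>n. X k (n - k)) = (\<Sum>(k,j)\<in>{(k,j). k + j \<le> K + N}. X k j)"
    by (rule sum.triangle_reindex_eq[symmetric])
  also have "\<dots> = (\<Sum>(k,j)\<in>{..K} \<times> {..N}. X k j)"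
  proof (rule sum.mono_neutral_right)
    have "{(k,j). k + j \<le> K + N} \<subseteq> {..K+N} \<times> {..K+N}" by auto
    then show "finite {(k,j). k + j \<le> K + N}" by (rule finite_subset) simp
    show "\<forall>i\<in>{(k, j). k + j \<le> K + N} - {..K} \<times> {..N}. (case i of (k, j) \<Rightarrow> X k j) = 0"
      by (auto intro!: assms)
  qed auto
  finally show ?thesis by (simp add: sum.cartesian_product)
qed

text \<open>
  The exponential \<open>e\<^sup>i\<^sup>\<theta>\<close> is central in the complexified quaternions, so there the product of power
  series becomes a pointwise product. These are its real and imaginary part. Quaternion-valued
  evaluation has no such property, and this is why the complexification enters.
\<close>
lemma cosum_sinsum_convolution:
  assumes a: "\<And>k. k > K \<Longrightarrow> a k = 0" and u: "\<And>j. j > N \<Longrightarrow> u j = 0"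
  shows "cosum (K + N) (\<lambda>n. \<Sum>k\<le>n. qcnj (a k) * u (n - k)) \<theta>
           = qcnj (cosum K a \<theta>) * cosum N u \<theta> - qcnj (sinsum K a \<theta>) * sinsum N u \<theta>" (is ?C)
    and "sinsum (K + N) (\<lambda>n. \<Sum>k\<le>n. qcnj (a k) * u (n - k)) \<theta>
           = qcnj (cosum K a \<theta>) * sinsum N u \<theta> + qcnj (sinsum K a \<theta>) * cosum N u \<theta>" (is ?S)
proof -
  have "cosum (K + N) (\<lambda>n. \<Sum>k\<le>n. qcnj (a k) * u (n - k)) \<theta>
    = (\<Sum>n\<le>K+N. \<Sum>k\<le>n. cos (real (k + (n - k)) * \<theta>) *\<^sub>R (qcnj (a k) * u (n - k)))"
    unfolding cosum_def scaleR_right.sum by (intro sum.cong) auto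
  also have "\<dots> = (\<Sum>k\<le>K. \<Sum>j\<le>N. cos (real (k + j) * \<theta>) *\<^sub>R (qcnj (a k) * u j))"
    by (rule sum_convolution) (auto simp: a u)
  also have "\<dots> = qcnj (cosum K a \<theta>) * cosum N u \<theta> - qcnj (sinsum K a \<theta>) * sinsum N u \<theta>"
    unfolding cosum_def sinsum_def qcnj_sum sum_product sum_subtractf[symmetric]
    by (intro sum.cong refl, simp add: distrib_right cos_add scaleR_diff_left)
       (simp add: mult.commute)
  finally show ?C .
  have "sinsum (K + N) (\<lambda>n. \<Sum>k\<le>n. qcnj (a k) * u (n - k)) \<theta>
    = (\<Sum>n\<le>K+N. \<Sum>k\<le>n. sin (real (k + (n - k)) * \<theta>) *\<^sub>R (qcnj (a k) * u (n - k)))"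
    unfolding sinsum_def scaleR_right.sum by (intro sum.cong) auto
  also have "\<dots> = (\<Sum>k\<le>K. \<Sum>j\<le>N. sin (real (k + j) * \<theta>) *\<^sub>R (qcnj (a k) * u j))"
    by (rule sum_convolution) (auto simp: a u)
  also have "\<dots> = qcnj (cosum K a \<theta>) * sinsum N u \<theta> + qcnj (sinsum K a \<theta>) * cosum N u \<theta>"
    unfolding cosum_def sinsum_def qcnj_sum sum_product sum.distrib[symmetric]
    by (intro sum.cong refl, simp add: distrib_right sin_add scaleR_add_left)
       (simp add: mult.commute add.commute)
  finally show ?S .
qed

lemma polynomial_toeplitz_contraction:
  assumes a: "\<And>k. k > K \<Longrightarrow> a k = 0" and u: "\<And>j. j > N \<Longrightarrow> u j = 0"
    and bound: "\<And>J \<theta>. J \<in> quat_S \<Longrightarrow> norm (cosum K a \<theta> + J * sinsum K a \<theta>) \<le> M"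
  shows "(\<Sum>n\<le>K+N. (norm (\<Sum>k\<le>n. qcnj (a k) * u (n - k)))\<^sup>2) \<le> M\<^sup>2 * (\<Sum>n\<le>N. (norm (u n))\<^sup>2)"
proof -
  let ?c = "\<lambda>n. \<Sum>k\<le>n. qcnj (a k) * u (n - k)"
  have "2 * pi * (\<Sum>n\<le>K+N. (norm (?c n))\<^sup>2) \<le> M\<^sup>2 * (2 * pi * (\<Sum>n\<le>N. (norm (u n))\<^sup>2))"
  proof (rule has_integral_le)
    show "((\<lambda>\<theta>. (norm (cosum (K+N) ?c \<theta>))\<^sup>2 + (norm (sinsum (K+N) ?c \<theta>))\<^sup>2) has_integral
       2 * pi * (\<Sum>n\<le>K+N. (norm (?c n))\<^sup>2)) {0..2*pi}"
      by (rule trig_parseval)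
    show "((\<lambda>\<theta>. M\<^sup>2 * ((norm (cosum N u \<theta>))\<^sup>2 + (norm (sinsum N u \<theta>))\<^sup>2)) has_integral
       M\<^sup>2 * (2 * pi * (\<Sum>n\<le>N. (norm (u n))\<^sup>2))) {0..2*pi}"
      by (intro has_integral_mult_right trig_parseval)
    show "(norm (cosum (K+N) ?c \<theta>))\<^sup>2 + (norm (sinsum (K+N) ?c \<theta>))\<^sup>2
      \<le> M\<^sup>2 * ((norm (cosum N u \<theta>))\<^sup>2 + (norm (sinsum N u \<theta>))\<^sup>2)" for \<theta>
    proof -
      have *: "cosum (K+N) ?c \<theta> = qcnj (cosum K a \<theta>) * cosum N u \<theta> - qcnj (sinsum K a \<theta>) * sinsum N u \<theta>"
        "sinsum (K+N) ?c \<theta> = qcnj (cosum K a \<theta>) * sinsum N u \<theta> + qcnj (sinsum K a \<theta>) * cosum N u \<theta>"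
        by (intro cosum_sinsum_convolution a u; assumption)+
      show ?thesis
        unfolding * by (rule biquaternion_contraction) (rule bound)
    qed
  qed
  then have "2 * pi * (\<Sum>n\<le>K+N. (norm (?c n))\<^sup>2) \<le> 2 * pi * (M\<^sup>2 * (\<Sum>n\<le>N. (norm (u n))\<^sup>2))"
    by (simp add: mult.left_commute)
  then show ?thesis by simp
qed

lemma quat_de_moivre:
  assumes "J \<in> quat_S"
  shows "(of_real (cos \<theta>) + of_real (sin \<theta>) * J) ^ n = of_real (cos (real n * \<theta>)) + of_real (sin (real n * \<theta>)) * J"
proof (induction n)
  case (Suc n)
  have JJ: "J * J = - 1" using assms by (simp add: quat_S_def power2_eq_square)
  have "(of_real c + of_real s * J) * (of_real a + of_real b * J)
     = of_real (c * a - s * b) + of_real (s * a + c * b) * J" for a b c s :: real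
    using JJ unfolding of_real_def by (simp add: algebra_simps)
  then show ?case
    unfolding power_Suc Suc by (simp add: cos_add sin_add distrib_right)
qed simp

text \<open>
  Convergence at the real points alone gives absolute convergence in the ball, since powers of a
  real point commute with the coefficients and the usual radius-of-convergence argument applies.
\<close>
lemma expansion_abs_summable:
  fixes F :: "nat \<Rightarrow> quat"
  assumes F: "\<And>x::real. \<bar>x\<bar> < 1 \<Longrightarrow> summable (\<lambda>n. of_real x ^ n * F n)" and r: "0 \<le> r" "r < 1"
  shows "summable (\<lambda>n. r ^ n * norm (F n))"
proof -
  let ?x = "of_real ((1 + r) / 2) :: quat"
  have x: "norm ?x = (1 + r) / 2" unfolding norm_of_real using r by simp
  have "summable (\<lambda>n. ?x ^ n * F n)"
    using F[of "(1 + r) / 2"] r by simp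
  moreover have "?x ^ n * F n = F n * ?x ^ n" for n
    by (metis Real_Vector_Spaces.of_real_power scaleR_conv_of_real mult_scaleR_right mult.right_neutral mult_scaleR_left mult_1)
  ultimately have "summable (\<lambda>n. F n * ?x ^ n)" by simp
  then have "summable (\<lambda>n. norm (F n * of_real r ^ n))"
    by (rule powser_insidea) (use r x in \<open>simp del: of_real_divide\<close>)
  then show ?thesis using r by (simp add: norm_mult norm_power mult.commute)
qed

text \<open>
  If \<open>f\<close> is bounded by 1 on the ball, convolution with its conjugated coefficients is a contraction
  of the finite sections of the space of square-summable sequences: pointwise on the circle of
  radius \<open>r\<close> this is \<open>biquaternion_contraction\<close>, Parseval turns it into a statement about
  coefficients, and \<open>r\<close> tends to 1. Parseval is applied to polynomials only, so \<open>f\<close> is truncated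
  after degree \<open>K\<close>; the truncation exceeds the bound 1 by at most the tail \<open>e K\<close>.
\<close>
theorem toeplitz_contraction:
  assumes f: "\<And>q::quat. q \<in> ball 0 1 \<Longrightarrow> (\<lambda>n. q ^ n * F n) sums f q"
    and bound: "\<And>q. q \<in> ball 0 1 \<Longrightarrow> norm (f q) \<le> 1"
  shows "(\<Sum>n\<le>N. (norm (\<Sum>k\<le>n. qcnj (F k) * u (n - k)))\<^sup>2) \<le> (\<Sum>n\<le>N. (norm (u n))\<^sup>2)"
proof -
  define T where "T r n = (\<Sum>k\<le>n. r ^ k *\<^sub>R (qcnj (F k) * u (n - k)))" for r :: real and n
  have main: "(\<Sum>n\<le>N. (norm (T r n))\<^sup>2) \<le> (\<Sum>n\<le>N. (norm (u n))\<^sup>2)" if r: "0 < r" "r < 1" for r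
  proof -
    have abs: "summable (\<lambda>n. r ^ n * norm (F n))"
      by (rule expansion_abs_summable) (use r in \<open>auto intro!: sums_summable[OF f]\<close>)
    define e where "e K = (\<Sum>n. r ^ (n + Suc K) * norm (F (n + Suc K)))" for K
    \<comment> \<open>a sum up to \<open>N\<close> does not see \<open>u n\<close> for \<open>n > N\<close>, so \<open>u\<close> may be cut off there\<close>
    define v where "v n = (if n \<le> N then u n else 0)" for n
    have ineq: "(\<Sum>n\<le>N. (norm (T r n))\<^sup>2) \<le> (1 + e K)\<^sup>2 * (\<Sum>n\<le>N. (norm (u n))\<^sup>2)" if "K \<ge> N" for K
    proof -
      define a where "a k = (if k \<le> K then r ^ k *\<^sub>R F k else 0)" for k
      have ab: "norm (cosum K a \<theta> + J * sinsum K a \<theta>) \<le> 1 + e K" if J: "J \<in> quat_S" for J \<theta>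
      proof -
        let ?w = "of_real (cos \<theta>) + of_real (sin \<theta>) * J"
        let ?q = "of_real r * ?w"
        have "(norm ?w)\<^sup>2 = 1"
          using J by (simp add: norm_add_sq quat_S_iff norm_mult)
        then have nw: "norm ?w = 1" by (simp add: power2_eq_1_iff) (metis norm_ge_zero not_one_le_zero neg_0_le_iff_le)
        then have nq: "norm ?q = r" using r by (simp add: norm_mult)
        have pw: "?q ^ k = r ^ k *\<^sub>R ?w ^ k" for k
          using scaleR_power[of r ?w k] by (simp only: scaleR_conv_of_real)
        have "cosum K a \<theta> + J * sinsum K a \<theta> = (\<Sum>k\<le>K. ?q ^ k * F k)"
          unfolding cosum_def sinsum_def sum_distrib_left sum.distrib[symmetric]
        proof (intro sum.cong refl)
          fix k assume "k \<in> {..K}"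
          then show "cos (real k * \<theta>) *\<^sub>R a k + J * sin (real k * \<theta>) *\<^sub>R a k = ?q ^ k * F k"
            unfolding pw quat_de_moivre[OF J]
            by (simp add: a_def distrib_right scaleR_add_right mult.commute[of "r ^ k"] flip: scaleR_conv_of_real) 
        qed
        also have "\<dots> = f ?q - (\<Sum>n. ?q ^ (n + Suc K) * F (n + Suc K))"
        proof -
          have s: "(\<lambda>k. ?q ^ k * F k) sums f ?q" by (rule f) (use nq r in simp)
          show ?thesis
            using suminf_split_initial_segment[OF sums_summable[OF s], of "Suc K"] sums_unique[OF s]
            by (simp add: lessThan_Suc_atMost algebra_simps)
        qed
        finally have "norm (cosum K a \<theta> + J * sinsum K a \<theta>)
            \<le> norm (f ?q) + norm (\<Sum>n. ?q ^ (n + Suc K) * F (n + Suc K))"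
          by (simp add: norm_triangle_ineq4)
        also have "norm (f ?q) \<le> 1" by (rule bound) (use nq r in simp)
        also have "norm (\<Sum>n. ?q ^ (n + Suc K) * F (n + Suc K)) \<le> e K"
        proof -
          have n: "norm (?q ^ m * F m) = r ^ m * norm (F m)" for m
            unfolding norm_mult norm_power using nq by (simp add: norm_mult)
          have "summable (\<lambda>n. norm (?q ^ (n + Suc K) * F (n + Suc K)))"
            unfolding n using abs by (subst summable_iff_shift)
          from summable_norm[OF this] show ?thesis unfolding n e_def .
        qed
        finally show ?thesis by simp
      qed
      have T: "T r n = (\<Sum>k\<le>n. qcnj (a k) * v (n - k))" if "n \<le> N" for n
        unfolding T_def using that \<open>K \<ge> N\<close> by (intro sum.cong) (auto simp: a_def v_def)
      have "(\<Sum>n\<le>N. (norm (T r n))\<^sup>2) = (\<Sum>n\<le>N. (norm (\<Sum>k\<le>n. qcnj (a k) * v (n - k)))\<^sup>2)"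
        using T by simp
      also have "\<dots> \<le> (\<Sum>n\<le>K+N. (norm (\<Sum>k\<le>n. qcnj (a k) * v (n - k)))\<^sup>2)"
        by (rule sum_mono2) auto
      also have "\<dots> \<le> (1 + e K)\<^sup>2 * (\<Sum>n\<le>N. (norm (v n))\<^sup>2)"
        by (rule polynomial_toeplitz_contraction[OF _ _ ab]) (auto simp: a_def v_def)
      also have "(\<Sum>n\<le>N. (norm (v n))\<^sup>2) = (\<Sum>n\<le>N. (norm (u n))\<^sup>2)"
        by (simp add: v_def)
      finally show ?thesis .
    qed
    have "e \<longlonglongrightarrow> 0"
      unfolding e_def using LIMSEQ_Suc[OF suminf_exist_split2[OF abs]] by simp
    then have "(\<lambda>K. (1 + e K)\<^sup>2 * (\<Sum>n\<le>N. (norm (u n))\<^sup>2)) \<longlonglongrightarrow> (1 + 0)\<^sup>2 * (\<Sum>n\<le>N. (norm (u n))\<^sup>2)"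
      by (intro tendsto_intros)
    then show ?thesis
      using LIMSEQ_le_const[of _ _ "\<Sum>n\<le>N. (norm (T r n))\<^sup>2"] ineq by auto
  qed
  have "((\<lambda>r. \<Sum>n\<le>N. (norm (T r n))\<^sup>2) \<longlongrightarrow> (\<Sum>n\<le>N. (norm (T 1 n))\<^sup>2)) (at_left 1)"
    unfolding T_def by (intro tendsto_intros)
  moreover have "eventually (\<lambda>r. (\<Sum>n\<le>N. (norm (T r n))\<^sup>2) \<le> (\<Sum>n\<le>N. (norm (u n))\<^sup>2)) (at_left (1::real))"
    using eventually_at_left_real[OF zero_less_one] by (rule eventually_mono) (use main in auto)
  ultimately have "(\<Sum>n\<le>N. (norm (T 1 n))\<^sup>2) \<le> (\<Sum>n\<le>N. (norm (u n))\<^sup>2)"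
    by (rule tendsto_upperbound) simp
  then show ?thesis by (simp add: T_def)
qed

text \<open>
  Reversing the order of the first \<open>N + 1\<close> entries turns the lower triangular sections of the
  previous theorem into upper triangular ones. The operator obtained is the adjoint of
  multiplication by \<open>f\<close> on the quaternionic Hardy space, written in coefficients.
\<close>
lemma toeplitz_adjoint_contraction:
  assumes f: "\<And>q::quat. q \<in> ball 0 1 \<Longrightarrow> (\<lambda>n. q ^ n * F n) sums f q"
    and bound: "\<And>q. q \<in> ball 0 1 \<Longrightarrow> norm (f q) \<le> 1"
  shows "(\<Sum>j\<le>N. (norm (\<Sum>k\<le>N-j. qcnj (F k) * w (j + k)))\<^sup>2) \<le> (\<Sum>j\<le>N. (norm (w j))\<^sup>2)"
proof -
  have "(\<Sum>j\<le>N. (norm (\<Sum>k\<le>N-j. qcnj (F k) * w (j + k)))\<^sup>2)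
     = (\<Sum>n\<le>N. (norm (\<Sum>k\<le>n. qcnj (F k) * w (N - (n - k))))\<^sup>2)"
    by (rule sum.reindex_bij_witness[of _ "\<lambda>j. N - j" "\<lambda>j. N - j"])
       (auto intro!: arg_cong[where f="\<lambda>x. (norm x)\<^sup>2"] sum.cong)
  also have "\<dots> \<le> (\<Sum>n\<le>N. (norm (w (N - n)))\<^sup>2)"
    using toeplitz_contraction[OF f bound, where u = "\<lambda>i. w (N - i)"] by simp
  also have "\<dots> = (\<Sum>j\<le>N. (norm (w j))\<^sup>2)"
    by (rule sum.reindex_bij_witness[of _ "\<lambda>j. N - j" "\<lambda>j. N - j"]) auto
  finally show ?thesis .
qed

text \<open>
  The passage from finite sections to square-summable \<open>w\<close>. The image \<open>t\<close> is given by its entries,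
  so that it can be computed in closed form for the vectors \<open>w\<close> of interest.
\<close>
lemma toeplitz_adjoint_contraction_l2:
  assumes f: "\<And>q::quat. q \<in> ball 0 1 \<Longrightarrow> (\<lambda>n. q ^ n * F n) sums f q"
    and bound: "\<And>q. q \<in> ball 0 1 \<Longrightarrow> norm (f q) \<le> 1"
    and t: "\<And>j. (\<lambda>k. qcnj (F k) * w (j + k)) sums t j"
    and w: "(\<lambda>j. (norm (w j))\<^sup>2) sums W" and T: "(\<lambda>j. (norm (t j))\<^sup>2) sums T"
  shows "T \<le> W"
proof -
  have "(\<Sum>j<M. (norm (t j))\<^sup>2) \<le> W" for M
  proof -
    have conv: "(\<lambda>N. \<Sum>k\<le>N-j. qcnj (F k) * w (j + k)) \<longlonglongrightarrow> t j" for j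
      using LIMSEQ_offset[of "\<lambda>N. \<Sum>k\<le>N-j. qcnj (F k) * w (j + k)" j "t j"] t[of j]
      by (simp add: sums_def_le)
    have "(\<lambda>N. \<Sum>j<M. (norm (\<Sum>k\<le>N-j. qcnj (F k) * w (j + k)))\<^sup>2) \<longlonglongrightarrow> (\<Sum>j<M. (norm (t j))\<^sup>2)"
      by (intro tendsto_intros conv)
    moreover have "(\<Sum>j<M. (norm (\<Sum>k\<le>N-j. qcnj (F k) * w (j + k)))\<^sup>2) \<le> W" if "N \<ge> M" for N
    proof -
      have "(\<Sum>j<M. (norm (\<Sum>k\<le>N-j. qcnj (F k) * w (j + k)))\<^sup>2)
        \<le> (\<Sum>j\<le>N. (norm (\<Sum>k\<le>N-j. qcnj (F k) * w (j + k)))\<^sup>2)"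
        using that by (intro sum_mono2) auto
      also have "\<dots> \<le> (\<Sum>j\<le>N. (norm (w j))\<^sup>2)"
        by (rule toeplitz_adjoint_contraction[OF f bound])
      also have "\<dots> \<le> W"
        using w sum_le_suminf[of "\<lambda>j. (norm (w j))\<^sup>2" "{..N}"] by (auto simp: sums_iff)
      finally show ?thesis .
    qed
    ultimately show ?thesis
      by (intro LIMSEQ_le_const2[of _ "\<Sum>j<M. (norm (t j))\<^sup>2"]) auto
  qed
  then show ?thesis
    using T by (intro LIMSEQ_le_const2[of "\<lambda>M. \<Sum>j<M. (norm (t j))\<^sup>2"]) (auto simp: sums_def)
qed

section \<open>Quaternionic power series on the unit ball\<close>

definition ball_convergent :: "quat fps \<Rightarrow> bool"
  where "ball_convergent a \<longleftrightarrow> (\<forall>r. 0 \<le> r \<longrightarrow> r < 1 \<longrightarrow> summable (\<lambda>n. r ^ n * norm (fps_nth a n)))"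

definition peval :: "quat fps \<Rightarrow> quat \<Rightarrow> quat"
  where "peval a q = (\<Sum>n. q ^ n * fps_nth a n)"

lemma ball_convergentD:
  "ball_convergent a \<Longrightarrow> 0 \<le> r \<Longrightarrow> r < 1 \<Longrightarrow> summable (\<lambda>n. r ^ n * norm (fps_nth a n))"
  by (simp add: ball_convergent_def)

lemma ball_convergent_abs_summable:
  assumes "ball_convergent a" "norm q < 1"
  shows "summable (\<lambda>n. norm (q ^ n * fps_nth a n))"
  using ball_convergentD[OF assms(1), of "norm q"] assms(2) by (simp add: norm_mult norm_power)

lemma peval_summable:
  assumes "ball_convergent a" "norm q < 1"
  shows "summable (\<lambda>n. q ^ n * fps_nth a n)"
  by (rule summable_norm_cancel) (rule ball_convergent_abs_summable[OF assms])

lemma peval_sums: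
  assumes "ball_convergent a" "norm q < 1"
  shows "(\<lambda>n. q ^ n * fps_nth a n) sums peval a q"
  unfolding peval_def by (intro summable_sums peval_summable assms)

lemma ball_convergent_comparison:
  assumes "ball_convergent b" "\<And>n. norm (fps_nth a n) \<le> C * norm (fps_nth b n)"
  shows "ball_convergent a"
  unfolding ball_convergent_def
proof safe
  fix r :: real assume r: "0 \<le> r" "r < 1"
  have "summable (\<lambda>n. C * (r ^ n * norm (fps_nth b n)))"
    by (intro summable_mult ball_convergentD assms r)
  then show "summable (\<lambda>n. r ^ n * norm (fps_nth a n))"
  proof (rule summable_comparison_test')
    fix n
    have "r ^ n * norm (fps_nth a n) \<le> r ^ n * (C * norm (fps_nth b n))"
      using assms(2)[of n] r by (intro mult_left_mono) auto
    then show "norm (r ^ n * norm (fps_nth a n)) \<le> C * (r ^ n * norm (fps_nth b n))"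
      using r by (simp add: mult.left_commute)
  qed
qed

lemma ball_convergent_bounded:
  assumes "\<And>n. norm (fps_nth a n) \<le> C"
  shows "ball_convergent a"
  unfolding ball_convergent_def
proof safe
  fix r :: real assume r: "0 \<le> r" "r < 1"
  have "summable (\<lambda>n. r ^ n * C)" using r by (intro summable_mult2 summable_geometric) auto
  then show "summable (\<lambda>n. r ^ n * norm (fps_nth a n))"
    by (rule summable_comparison_test') (use r assms in \<open>auto intro: mult_left_mono\<close>)
qed

lemma ball_convergent_add:
  assumes "ball_convergent a" "ball_convergent b"
  shows "ball_convergent (a + b)"
  unfolding ball_convergent_def
proof safe
  fix r :: real assume r: "0 \<le> r" "r < 1"
  have "summable (\<lambda>n. r ^ n * norm (fps_nth a n) + r ^ n * norm (fps_nth b n))"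
    by (intro summable_add ball_convergentD assms r)
  then show "summable (\<lambda>n. r ^ n * norm (fps_nth (a + b) n))"
    by (rule summable_comparison_test')
       (use r in \<open>auto simp: distrib_left[symmetric] intro!: mult_left_mono norm_triangle_ineq\<close>)
qed

lemma ball_convergent_uminus: "ball_convergent a \<Longrightarrow> ball_convergent (- a)"
  by (rule ball_convergent_comparison[where C=1]) auto

lemma ball_convergent_diff: "ball_convergent a \<Longrightarrow> ball_convergent b \<Longrightarrow> ball_convergent (a - b)"
  using ball_convergent_add[OF _ ball_convergent_uminus, of a b] by simp

lemma ball_convergent_const [simp]: "ball_convergent (fps_const c)"
  by (rule ball_convergent_bounded[where C="norm c"]) auto

lemma ball_convergent_1 [simp]: "ball_convergent 1"
  using ball_convergent_const[of 1] by simp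

lemma ball_convergent_X [simp]: "ball_convergent fps_X"
  by (rule ball_convergent_bounded[where C=1]) auto

lemma ball_convergent_mult_const: "ball_convergent a \<Longrightarrow> ball_convergent (a * fps_const c)"
  by (rule ball_convergent_comparison[where C="norm c"]) (auto simp: norm_mult mult.commute)

text \<open>
  A Cauchy product for double families that are dominated by a product but need not be
  products themselves: in \<open>q ^ (k + j) * a * b\<close> the factor \<open>a\<close> does not commute with \<open>q ^ k\<close>.
\<close>
lemma double_sum_sums:
  fixes g :: "nat \<Rightarrow> nat \<Rightarrow> 'a :: banach"
  assumes bound: "\<And>k j. norm (g k j) \<le> x k * y j"
    and x: "summable x" "\<And>k. 0 \<le> x k" and y: "summable y" "\<And>j. 0 \<le> y j"
    and t: "\<And>k. (\<lambda>j. g k j) sums t k"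
  shows "summable t" "(\<lambda>n. \<Sum>k\<le>n. g k (n - k)) sums suminf t"
proof -
  have "(\<lambda>(k,j). x k * y j) summable_on (UNIV \<times> UNIV)"
  proof (rule summable_on_SigmaI)
    show "((\<lambda>j. case (k, j) of (k, j) \<Rightarrow> x k * y j) has_sum x k * suminf y) UNIV" for k
      using sums_mult[OF summable_sums[OF y(1)], of "x k"] x(2) y(2)
      by (auto intro!: sums_nonneg_imp_has_sum)
    show "(\<lambda>k. x k * suminf y) summable_on UNIV"
      using x y by (intro summable_nonneg_imp_summable_on summable_mult2) (auto intro!: mult_nonneg_nonneg suminf_nonneg)
  qed (use x y in auto)
  then have "(\<lambda>z. norm (case z of (k,j) \<Rightarrow> g k j)) summable_on (UNIV \<times> UNIV)"
    by (rule Infinite_Sum.abs_summable_on_comparison_test') (use bound in auto)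
  then have "(\<lambda>(k,j). g k j) summable_on (UNIV \<times> UNIV)"
    by (rule abs_summable_summable)
  then obtain S where S: "((\<lambda>(k,j). g k j) has_sum S) (UNIV \<times> UNIV)"
    by (auto simp: summable_on_def)
  have "(t has_sum S) UNIV"
  proof (rule has_sum_SigmaD[OF S])
    fix k
    have "summable (\<lambda>j. norm (g k j))"
      by (rule summable_comparison_test'[OF summable_mult[OF y(1), of "x k"]]) (use bound in auto)
    then show "((\<lambda>j. case (k, j) of (k, j) \<Rightarrow> g k j) has_sum t k) UNIV"
      using norm_summable_imp_has_sum[OF _ t[of k]] by simp
  qed
  then have t': "t sums S" by (rule has_sum_imp_sums)
  then show "summable t" by (simp add: sums_iff)
  have "((\<lambda>(n,k). g k (n - k)) has_sum S) (SIGMA n:UNIV. {..n})"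
    using S by (subst has_sum_reindex_bij_witness[of _ "\<lambda>(k,j). (k+j,k)" "\<lambda>(n,k). (k,n-k)" "UNIV \<times> UNIV" "\<lambda>(k,j). g k j" _ S S]) auto
  then have "((\<lambda>n. \<Sum>k\<le>n. g k (n - k)) has_sum S) UNIV"
    by (rule has_sum_SigmaD) auto
  then show "(\<lambda>n. \<Sum>k\<le>n. g k (n - k)) sums suminf t"
    using t' by (auto dest!: has_sum_imp_sums simp: sums_iff)
qed

lemma ball_convergent_mult:
  assumes "ball_convergent a" "ball_convergent b"
  shows "ball_convergent (a * b)"
  unfolding ball_convergent_def
proof safe
  fix r :: real assume r: "0 \<le> r" "r < 1"
  have "summable (\<lambda>n. \<Sum>k\<le>n. (r ^ k * norm (fps_nth a k)) * (r ^ (n - k) * norm (fps_nth b (n - k))))"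
    by (intro summable_Cauchy_product) (use r ball_convergentD[OF assms(1) r] ball_convergentD[OF assms(2) r] in auto)
  then show "summable (\<lambda>n. r ^ n * norm (fps_nth (a * b) n))"
  proof (rule summable_comparison_test')
    fix n
    have "norm (fps_nth (a * b) n) \<le> (\<Sum>k\<le>n. norm (fps_nth a k) * norm (fps_nth b (n - k)))"
      unfolding fps_mult_nth atLeast0AtMost by (rule sum_norm_le) (simp add: norm_mult)
    then have "r ^ n * norm (fps_nth (a * b) n) \<le> r ^ n * (\<Sum>k\<le>n. norm (fps_nth a k) * norm (fps_nth b (n - k)))"
      using r by (intro mult_left_mono) auto
    also have "\<dots> = (\<Sum>k\<le>n. (r ^ k * norm (fps_nth a k)) * (r ^ (n - k) * norm (fps_nth b (n - k))))"
      unfolding sum_distrib_left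
    proof (intro sum.cong refl)
      fix k assume "k \<in> {..n}"
      then have "r ^ n = r ^ k * r ^ (n - k)" by (simp flip: power_add)
      then show "r ^ n * (norm (fps_nth a k) * norm (fps_nth b (n - k)))
        = (r ^ k * norm (fps_nth a k)) * (r ^ (n - k) * norm (fps_nth b (n - k)))" by simp
    qed
    finally show "norm (r ^ n * norm (fps_nth (a * b) n)) \<le> \<dots>" using r by simp
  qed
qed

text \<open>
  Evaluation is not multiplicative, but only the value \<open>peval a q\<close> of the left factor enters: it
  is placed between the powers of \<open>q\<close> and the coefficients of the right factor.
\<close>
lemma peval_mult:
  assumes "ball_convergent a" "ball_convergent b" "norm q < 1"
  shows "(\<lambda>k. q ^ k * peval a q * fps_nth b k) sums peval (a * b) q"
proof -
  define g where "g k j = q ^ (k + j) * fps_nth a j * fps_nth b k" for k j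
  define t where "t k = q ^ k * peval a q * fps_nth b k" for k
  have g: "g k j = q ^ k * (q ^ j * fps_nth a j) * fps_nth b k" for k j
    by (simp add: g_def power_add mult.assoc)
  have t: "(\<lambda>j. g k j) sums t k" for k
    unfolding g t_def by (intro sums_mult sums_mult2 peval_sums assms)
  have 1: "norm (g k j) \<le> norm (q ^ k * fps_nth b k) * norm (q ^ j * fps_nth a j)" for k j
    unfolding g by (simp add: norm_mult)
  note ds = double_sum_sums[of g, OF 1 ball_convergent_abs_summable[OF assms(2,3)] norm_ge_zero
      ball_convergent_abs_summable[OF assms(1,3)] norm_ge_zero t]
  have "(\<Sum>k\<le>n. g k (n - k)) = q ^ n * fps_nth (a * b) n" for n
  proof -
    have "(\<Sum>k\<le>n. g k (n - k)) = (\<Sum>k\<le>n. q ^ n * (fps_nth a (n - k) * fps_nth b k))"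
      by (intro sum.cong) (auto simp: g_def mult.assoc)
    also have "\<dots> = (\<Sum>k\<le>n. q ^ n * (fps_nth a k * fps_nth b (n - k)))"
      by (rule sum.reindex_bij_witness[of _ "\<lambda>j. n - j" "\<lambda>j. n - j"]) auto
    finally show ?thesis by (simp add: fps_mult_nth atLeast0AtMost sum_distrib_left)
  qed
  then have "peval (a * b) q = suminf t"
    unfolding peval_def using sums_unique[OF ds(2)] by simp
  then show ?thesis
    using ds(1) unfolding t_def[symmetric] by (simp add: summable_sums)
qed

lemma peval_add: "ball_convergent a \<Longrightarrow> ball_convergent b \<Longrightarrow> norm q < 1 \<Longrightarrow> peval (a + b) q = peval a q + peval b q"
  unfolding peval_def
  by (subst suminf_add) (auto simp: distrib_left peval_summable)

lemma peval_diff: "ball_convergent a \<Longrightarrow> ball_convergent b \<Longrightarrow> norm q < 1 \<Longrightarrow> peval (a - b) q = peval a q - peval b q"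
  unfolding peval_def
  by (subst suminf_diff) (auto simp: right_diff_distrib peval_summable)

lemma peval_const [simp]: "peval (fps_const c) q = c"
proof -
  have "(\<lambda>n. q ^ n * fps_nth (fps_const c) n) = (\<lambda>n. if n = 0 then c else 0)" by auto
  then show ?thesis unfolding peval_def using sums_single[of 0 "\<lambda>_. c"] by (simp add: sums_iff)
qed

lemma peval_1 [simp]: "peval 1 q = 1"
  using peval_const[of 1] by simp

lemma peval_mult_const: "ball_convergent a \<Longrightarrow> norm q < 1 \<Longrightarrow> peval (a * fps_const c) q = peval a q * c"
  unfolding peval_def
  by (subst suminf_mult2) (auto simp: mult.assoc peval_summable)

lemma peval_X [simp]: "peval fps_X q = q"
proof -
  have "(\<lambda>n. q ^ n * fps_nth fps_X n) = (\<lambda>n. if n = 1 then q else 0)" by auto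
  then show ?thesis unfolding peval_def using sums_single[of 1 "\<lambda>_. q"] by (simp add: sums_iff)
qed

lemma peval_X_mult:
  assumes "ball_convergent a" "norm q < 1" shows "peval (fps_X * a) q = q * peval a q"
proof -
  have "(\<lambda>k. q ^ k * peval fps_X q * fps_nth a k) sums peval (fps_X * a) q"
    by (intro peval_mult assms ball_convergent_X)
  moreover have "q ^ k * peval fps_X q * fps_nth a k = q * (q ^ k * fps_nth a k)" for k
    by (metis mult.assoc peval_X power_commutes)
  ultimately show ?thesis
    using sums_unique2[OF _ sums_mult[OF peval_sums[OF assms], of q]] by simp
qed

lemma peval_0: "peval a 0 = fps_nth a 0"
proof -
  have "(\<lambda>n. (0::quat) ^ n * fps_nth a n) = (\<lambda>n. if n = 0 then fps_nth a 0 else 0)" by auto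
  then show ?thesis unfolding peval_def using sums_single[of 0 "\<lambda>_. fps_nth a 0"] by (simp add: sums_iff)
qed

lemma regular_coeffs_peval:
  assumes "ball_convergent a" "\<And>q. q \<in> ball 0 1 \<Longrightarrow> f q = peval a q"
  shows "regular_coeffs f = fps_nth a"
  using assms by (intro regular_coeffs_eqI) (auto intro!: peval_sums)

lemma regular_mult_peval:
  assumes "regular_coeffs f = fps_nth a" "regular_coeffs g = fps_nth b"
  shows "(f \<star> g) q = peval (a * b) q"
  by (simp add: regular_mult_def peval_def assms fps_mult_nth atLeast0AtMost)

definition fps_qcnj :: "quat fps \<Rightarrow> quat fps"
  where "fps_qcnj a = Abs_fps (\<lambda>n. qcnj (fps_nth a n))"

lemma fps_qcnj_nth [simp]: "fps_nth (fps_qcnj a) n = qcnj (fps_nth a n)"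
  by (simp add: fps_qcnj_def)

lemma fps_qcnj_mult: "fps_qcnj (a * b) = fps_qcnj b * fps_qcnj a"
proof (rule fps_ext)
  fix n
  have "fps_nth (fps_qcnj (a * b)) n = (\<Sum>i\<le>n. qcnj (fps_nth b (n - i)) * qcnj (fps_nth a i))"
    by (simp add: fps_mult_nth qcnj_sum atLeast0AtMost)
  also have "\<dots> = (\<Sum>i\<le>n. qcnj (fps_nth b i) * qcnj (fps_nth a (n - i)))"
    by (rule sum.reindex_bij_witness[of _ "\<lambda>j. n - j" "\<lambda>j. n - j"]) auto
  finally show "fps_nth (fps_qcnj (a * b)) n = fps_nth (fps_qcnj b * fps_qcnj a) n"
    by (simp add: fps_mult_nth atLeast0AtMost)
qed

lemma fps_qcnj_simps [simp]: "fps_qcnj (fps_qcnj a) = a" "fps_qcnj 1 = 1"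
  by (auto simp: fps_eq_iff)

lemma ball_convergent_qcnj: "ball_convergent a \<Longrightarrow> ball_convergent (fps_qcnj a)"
  by (rule ball_convergent_comparison[where C=1]) auto

lemma qcnj_fixed_real: "qcnj x = x \<Longrightarrow> x = of_real (qre x)"
  by (simp add: quat_eq_iff)

lemma of_real_commute: "of_real r * x = x * (of_real r :: quat)"
  by (simp add: quat_eq_iff)

text \<open>
  A power series fixed by coefficientwise conjugation has real coefficients. It is therefore
  central, and its values commute with the point at which they are taken.
\<close>
lemma real_coeffs_central:
  assumes "fps_qcnj s = s"
  shows "fps_nth s k * x = x * fps_nth s k"
proof -
  have "fps_nth s k = of_real (qre (fps_nth s k))"
    by (rule qcnj_fixed_real) (metis assms fps_qcnj_nth)
  then show ?thesis by (metis of_real_commute)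
qed

lemma real_fps_commute:
  assumes "fps_qcnj s = s"
  shows "s * b = b * s"
proof (rule fps_ext)
  fix n
  note s = real_coeffs_central[OF assms]
  have "(\<Sum>i\<le>n. fps_nth s i * fps_nth b (n - i)) = (\<Sum>i\<le>n. fps_nth b i * fps_nth s (n - i))"
    by (rule sum.reindex_bij_witness[of _ "\<lambda>j. n - j" "\<lambda>j. n - j"]) (simp_all add: s[symmetric])
  then show "fps_nth (s * b) n = fps_nth (b * s) n"
    by (simp add: fps_mult_nth atLeast0AtMost)
qed

lemma peval_real_mult:
  assumes "fps_qcnj s = s" "ball_convergent s" "ball_convergent b" "norm q < 1"
  shows "peval (s * b) q = peval s q * peval b q"
proof -
  note s = real_coeffs_central[OF assms(1)]
  have "(\<lambda>n. q ^ n * fps_nth s n * q) sums (peval s q * q)"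
    by (intro sums_mult2 peval_sums assms)
  moreover have "q ^ n * fps_nth s n * q = q * (q ^ n * fps_nth s n)" for n
    by (simp only: mult.assoc s) (simp only: mult.assoc[symmetric] power_commutes)
  ultimately have comm: "peval s q * q = q * peval s q"
    using sums_unique2[OF _ sums_mult[OF peval_sums[OF assms(2,4)], of q]] by simp
  have comm': "q ^ k * peval s q = peval s q * q ^ k" for k
    using power_commuting_commutes[of q "peval s q" k] comm by simp
  have "(\<lambda>k. q ^ k * peval s q * fps_nth b k) sums peval (s * b) q"
    by (intro peval_mult assms)
  then have "(\<lambda>k. peval s q * (q ^ k * fps_nth b k)) sums peval (s * b) q"
    by (simp add: comm' mult.assoc)
  then show ?thesis
    by (rule sums_unique2[OF _ sums_mult[OF peval_sums[OF assms(3,4)]]])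
qed

text \<open>
  The regular reciprocal is the reciprocal in the ring of power series, as soon as that one
  converges. The symmetrization \<open>s = g * fps_qcnj g\<close> has real coefficients, and so has
  \<open>t = L * fps_qcnj L\<close>. Hence \<open>s * t = 1\<close> and \<open>s * L = fps_qcnj g\<close> may be evaluated factor by
  factor; the former shows that \<open>s\<close> has no zero in the ball.
\<close>
lemma regular_recip_peval:
  assumes g: "regular_coeffs f = fps_nth g" "ball_convergent g"
    and L: "L * g = 1" "g * L = 1" "ball_convergent L" and q: "norm q < 1"
  shows "regular_recip f q = peval L q"
proof -
  let ?s = "g * fps_qcnj g" and ?t = "L * fps_qcnj L"
  have conj: "regular_conj f q = peval (fps_qcnj g) q" for q
    by (simp add: regular_conj_def peval_def g)
  have conv: "ball_convergent (fps_qcnj g)" "ball_convergent ?s" "ball_convergent ?t"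
    by (intro ball_convergent_mult ball_convergent_qcnj g L)+
  have "regular_coeffs (regular_conj f) = fps_nth (fps_qcnj g)"
    by (rule regular_coeffs_peval[OF conv(1) conj])
  then have sym: "symmetrization f q = peval ?s q"
    unfolding symmetrization_def by (rule regular_mult_peval[OF g(1)])
  have s: "fps_qcnj ?s = ?s" by (simp add: fps_qcnj_mult)
  have sL: "?s * L = fps_qcnj g"
    unfolding real_fps_commute[OF s] by (simp add: mult.assoc[symmetric] L)
  have "?s * ?t = fps_qcnj g * fps_qcnj L"
    by (metis sL mult.assoc)
  also have "\<dots> = 1" by (simp add: fps_qcnj_mult[symmetric] L)
  finally have "peval ?s q * peval ?t q = 1"
    using peval_real_mult[OF s conv(2,3) q] by simp
  then have "peval ?s q \<noteq> 0" by auto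
  moreover have "peval ?s q * peval L q = peval (fps_qcnj g) q"
    using peval_real_mult[OF s conv(2) L(3) q] sL by simp
  ultimately show ?thesis
    unfolding regular_recip_def sym conj
    by (metis left_inverse mult.assoc mult_1)
qed

text \<open>
  The Caratheodory coefficient bound for \<open>2 * L - 1 = (1 - a)\<^sup>-\<^sup>1 * (1 + a)\<close>, whose real part is
  nonnegative. If \<open>T\<close> denotes multiplication by \<open>a\<close>, then the adjoint of \<open>1 - T\<close> maps the finitely
  supported vector \<open>w\<close>, formed from the conjugated coefficients of \<open>L\<close>, to the vector \<open>u\<close> supported
  at \<open>0\<close> and \<open>n\<close>. So \<open>norm (w - u) \<le> norm w\<close>, and after cancellation only the entries \<open>0\<close> and \<open>n\<close>
  remain. The argument concerns coefficients only; its use is to prove that \<open>L\<close> converges on the ball.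
\<close>
lemma cayley_coefficient_bound:
  assumes f: "\<And>q::quat. q \<in> ball 0 1 \<Longrightarrow> (\<lambda>n. q ^ n * fps_nth a n) sums f q"
    and bound: "\<And>q. q \<in> ball 0 1 \<Longrightarrow> norm (f q) \<le> 1"
    and L: "L * (1 - a) = 1" and n: "n \<ge> 1"
  shows "norm (fps_nth L n) \<le> 2 * qre (fps_nth L 0) - 1"
proof -
  \<comment> \<open>the unit quaternion that makes \<open>qcnj (fps_nth L n) * d\<close> real and as small as possible\<close>
  define d where "d = (if fps_nth L n = 0 then 1 else - (fps_nth L n /\<^sub>R norm (fps_nth L n)))"
  have d: "norm d = 1" by (simp add: d_def)
  have Ld: "qcnj (fps_nth L n) * d = - of_real (norm (fps_nth L n))"
  proof (cases "fps_nth L n = 0")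
    case False
    have "qcnj (fps_nth L n) * d = - (inverse (norm (fps_nth L n)) *\<^sub>R (qcnj (fps_nth L n) * fps_nth L n))"
      using False by (simp add: d_def)
    also have "\<dots> = - of_real (inverse (norm (fps_nth L n)) * (norm (fps_nth L n))\<^sup>2)"
      by (simp only: mult_qcnj scaleR_conv_of_real of_real_mult)
    also have "inverse (norm (fps_nth L n)) * (norm (fps_nth L n))\<^sup>2 = norm (fps_nth L n)"
      using False by (simp add: power2_eq_square)
    finally show ?thesis .
  qed (simp add: d_def)
  have La: "L * a = L - 1" using L by (simp add: right_diff_distrib diff_eq_eq eq_diff_eq add.commute)
  have conv: "(\<Sum>k\<le>m. qcnj (fps_nth a k) * qcnj (fps_nth L (m - k))) = qcnj (fps_nth L m) - (if m = 0 then 1 else 0)" for m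
  proof -
    have "fps_qcnj (L * a) = fps_qcnj a * fps_qcnj L" by (rule fps_qcnj_mult)
    then have "fps_nth (fps_qcnj (L - 1)) m = fps_nth (fps_qcnj a * fps_qcnj L) m" by (simp add: La)
    then show ?thesis by (simp add: fps_mult_nth atLeast0AtMost split: if_splits)
  qed
  define u where "u j = (if j = 0 then 1 else if j = n then d else 0)" for j
  define w where "w j = qcnj (fps_nth L (n - j)) * d + (if j = 0 then qcnj (fps_nth L 0) else 0)" for j
  have Tw: "(\<Sum>k\<le>n-j. qcnj (fps_nth a k) * w (j + k)) = w j - u j" if "j \<le> n" for j
  proof -
    have "(\<Sum>k\<le>n-j. qcnj (fps_nth a k) * w (j + k))
      = (\<Sum>k\<le>n-j. qcnj (fps_nth a k) * qcnj (fps_nth L (n - j - k))) * d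
        + (\<Sum>k\<le>n-j. if k = 0 then if j = 0 then qcnj (fps_nth a 0) * qcnj (fps_nth L 0) else 0 else 0)"
      unfolding sum_distrib_right sum.distrib[symmetric]
      by (intro sum.cong) (auto simp: w_def distrib_left mult.assoc)
    also have "\<dots> = w j - u j"
    proof -
      have "qcnj (fps_nth a 0) * qcnj (fps_nth L 0) = qcnj (fps_nth L 0) - 1" using conv[of 0] by simp
      then show ?thesis
        using n \<open>j \<le> n\<close> unfolding conv by (auto simp: w_def u_def algebra_simps)
    qed
    finally show ?thesis .
  qed
  have "(\<Sum>j\<le>n. (norm (w j - u j))\<^sup>2) \<le> (\<Sum>j\<le>n. (norm (w j))\<^sup>2)"
    using toeplitz_adjoint_contraction[OF f bound, where N = n and w = w] Tw by simp
  then have "(\<Sum>j\<le>n. (norm (w j - u j))\<^sup>2 - (norm (w j))\<^sup>2) \<le> 0"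
    by (simp add: sum_subtractf)
  also have "(\<Sum>j\<le>n. (norm (w j - u j))\<^sup>2 - (norm (w j))\<^sup>2) = (\<Sum>j\<in>{0,n}. (norm (w j - u j))\<^sup>2 - (norm (w j))\<^sup>2)"
    by (rule sum.mono_neutral_right) (auto simp: u_def)
  also have "\<dots> = (norm (w 0 - 1))\<^sup>2 - (norm (w 0))\<^sup>2 + ((norm (w n - d))\<^sup>2 - (norm (w n))\<^sup>2)"
    using n by (simp add: u_def)
  also have "\<dots> = 2 - 2 * (qre (w 0) + w n \<bullet> d)"
  proof -
    have *: "(norm (x - y))\<^sup>2 - (norm x)\<^sup>2 = (norm y)\<^sup>2 - 2 * (x \<bullet> y)" for x y :: quat
      by (simp add: power2_norm_eq_inner inner_diff inner_commute)
    have "w 0 \<bullet> 1 = qre (w 0)" by (simp add: inner_quat_def)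
    then show ?thesis unfolding * using d by simp
  qed
  also have "w n \<bullet> d = qre (fps_nth L 0)"
  proof -
    have "w n \<bullet> d = d \<bullet> (qcnj (fps_nth L 0) * d)" using n by (simp add: w_def inner_commute)
    also have "\<dots> = qre (qcnj (fps_nth L 0) * d * qcnj d)"
      using qre_mult_commute by (simp only: inner_eq_qre)
    also have "qcnj (fps_nth L 0) * d * qcnj d = qcnj (fps_nth L 0)" by (simp only: mult.assoc mult_qcnj d) simp
    finally show ?thesis by simp
  qed
  also have "qre (w 0) = qre (fps_nth L 0) - norm (fps_nth L n)"
    by (simp add: w_def Ld del: quat_ring_sel(20))
  finally show ?thesis by simp
qed

section \<open>The regular Cayley transform\<close>

definition ball_self_map :: "quat fps \<Rightarrow> bool"
  where "ball_self_map a \<longleftrightarrow> ball_convergent a \<and> (\<forall>q\<in>ball 0 1. norm (peval a q) < 1)"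

lemma ball_self_map_nth0: "ball_self_map a \<Longrightarrow> norm (fps_nth a 0) < 1"
  unfolding ball_self_map_def by (metis centre_in_ball peval_0 zero_less_one)

lemma inverse_one_minus:
  fixes a :: "quat fps"
  assumes "ball_self_map a"
  shows "inverse (1 - a) * (1 - a) = 1" "(1 - a) * inverse (1 - a) = 1"
    "inverse (1 - a) * a = inverse (1 - a) - 1"
proof -
  have "fps_nth (1 - a) 0 \<noteq> 0" using ball_self_map_nth0[OF assms] by auto
  then show *: "inverse (1 - a) * (1 - a) = 1" "(1 - a) * inverse (1 - a) = 1"
    by (rule inverse_mult_eq_1, rule inverse_mult_eq_1')
  show "inverse (1 - a) * a = inverse (1 - a) - 1"
    using *(1) by (simp add: right_diff_distrib diff_eq_eq eq_diff_eq add.commute)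
qed

lemma ball_convergent_inverse_one_minus:
  assumes a: "ball_self_map a"
  shows "ball_convergent (inverse (1 - a))"
proof (rule ball_convergent_bounded)
  let ?L = "inverse (1 - a)"
  have conv: "ball_convergent a" and bd: "\<And>q. q \<in> ball 0 1 \<Longrightarrow> norm (peval a q) \<le> 1"
    using a by (auto simp: ball_self_map_def less_imp_le)
  show "norm (fps_nth ?L n) \<le> norm (fps_nth ?L 0) + \<bar>2 * qre (fps_nth ?L 0) - 1\<bar>" for n
  proof (cases "n = 0")
    case False
    have "norm (fps_nth ?L n) \<le> 2 * qre (fps_nth ?L 0) - 1"
      by (rule cayley_coefficient_bound[OF peval_sums[OF conv] bd inverse_one_minus(1)[OF a]])
         (use False in auto)
    then show ?thesis using norm_ge_zero[of "fps_nth ?L 0"] by linarith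
  qed simp
qed

text \<open>
  Since \<open>1 + a = 2 - (1 - a)\<close>, the Cayley transform is an affine function of the resolvent
  \<open>inverse (1 - a)\<close>, and only the resolvent has to be studied.
\<close>
lemma regular_cayley_eq:
  assumes a: "ball_self_map a" and f: "\<And>q. q \<in> ball 0 1 \<Longrightarrow> f q = peval a q" and q: "q \<in> ball 0 1"
  shows "regular_cayley f q = 2 * peval (inverse (1 - a)) q - 1"
proof -
  let ?L = "inverse (1 - a)"
  have conv: "ball_convergent a" "ball_convergent ?L" "ball_convergent (1 - a)" "ball_convergent (1 + a)"
    using a ball_convergent_inverse_one_minus[OF a] by (auto simp: ball_self_map_def intro!: ball_convergent_diff ball_convergent_add)
  have 1: "regular_coeffs (\<lambda>q. 1 - f q) = fps_nth (1 - a)"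
    by (rule regular_coeffs_peval) (auto simp: conv f peval_diff)
  have 2: "regular_coeffs (\<lambda>q. 1 + f q) = fps_nth (1 + a)"
    by (rule regular_coeffs_peval) (auto simp: conv f peval_add)
  have 3: "regular_coeffs (regular_recip (\<lambda>q. 1 - f q)) = fps_nth ?L"
    by (rule regular_coeffs_peval[OF conv(2)])
       (auto intro!: regular_recip_peval[OF 1 conv(3)] inverse_one_minus a conv)
  have "regular_cayley f q = peval (?L * (1 + a)) q"
    unfolding regular_cayley_def by (rule regular_mult_peval[OF 3 2])
  also have "?L * (1 + a) = ?L + ?L - 1"
    by (simp add: distrib_left inverse_one_minus[OF a])
  finally show ?thesis
    using q conv by (simp add: peval_diff peval_add ball_convergent_add mult_2)
qed

text \<open>
  Applied to a value \<open>x\<close> of the resolvent, this writes the real part of the Cayley transform as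
  the difference of squares that the Pick inequality produces.
\<close>
lemma qre_two_minus_one: "qre (2 * x - 1) = (norm x)\<^sup>2 - (norm (x - 1))\<^sup>2"
  unfolding norm_quat_power2 mult_2 by (simp add: power2_eq_square algebra_simps)

section \<open>The Pick inequality and its boundary limit\<close>

text \<open>
  For \<open>X = 1\<close> this is the Szego kernel of the quaternionic Hardy space; the coefficient \<open>X\<close> sits in
  the middle because it commutes neither with \<open>q\<close> nor with \<open>p\<close>.
\<close>
definition szego :: "quat \<Rightarrow> quat \<Rightarrow> quat \<Rightarrow> quat"
  where "szego q p X = (\<Sum>j. q ^ j * X * qcnj p ^ j)"

lemma szego_sums:
  assumes "norm q < 1" "norm p \<le> 1"
  shows "(\<lambda>j. q ^ j * X * qcnj p ^ j) sums szego q p X"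
proof -
  have "norm (norm q * norm p) < 1"
    using assms mult_left_le[of "norm p" "norm q"] by (simp add: abs_mult)
  then have "summable (\<lambda>j. (norm q * norm p) ^ j * norm X)"
    by (intro summable_mult2 summable_geometric)
  then have "summable (\<lambda>j. norm (q ^ j * X * qcnj p ^ j))"
    by (simp add: norm_mult norm_power power_mult_distrib mult_ac)
  then show ?thesis
    unfolding szego_def by (rule summable_sums[OF summable_norm_cancel])
qed

lemma szego_diff:
  assumes "norm q < 1" "norm p \<le> 1"
  shows "szego q p (X - Y) = szego q p X - szego q p Y"
proof (rule sums_unique2[OF szego_sums[OF assms]])
  show "(\<lambda>j. q ^ j * (X - Y) * qcnj p ^ j) sums (szego q p X - szego q p Y)"
    using sums_diff[OF szego_sums[OF assms, of X] szego_sums[OF assms, of Y]]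
    by (simp add: left_diff_distrib right_diff_distrib)
qed

text \<open>
  The substitute for the closed form \<open>X / (1 - q * qcnj p)\<close>, which is available in the commutative case only.
  The equation determines the kernel, also for \<open>p\<close> on the unit sphere.
\<close>
lemma szego_rec:
  assumes "norm q < 1" "norm p \<le> 1"
  shows "szego q p X = X + q * szego q p X * qcnj p"
proof -
  have "(\<lambda>j. q * (q ^ j * X * qcnj p ^ j) * qcnj p) sums (q * szego q p X * qcnj p)"
    by (intro sums_mult sums_mult2 szego_sums assms)
  moreover have "q * (q ^ j * X * qcnj p ^ j) * qcnj p = q ^ Suc j * X * qcnj p ^ Suc j" for j
    by (simp only: mult.assoc power_Suc power_commutes)
  ultimately have "(\<lambda>j. q ^ Suc j * X * qcnj p ^ Suc j) sums (q * szego q p X * qcnj p)" by simp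
  from sums_Suc[OF this] have "(\<lambda>j. q ^ j * X * qcnj p ^ j) sums (q * szego q p X * qcnj p + X)"
    by simp
  from sums_unique2[OF szego_sums[OF assms] this] show ?thesis by (simp only: add.commute)
qed

lemma szego_unique:
  assumes "norm q < 1" "norm p \<le> 1" "Z = X + q * Z * qcnj p"
  shows "Z = szego q p X"
proof -
  let ?d = "Z - szego q p X"
  have "?d = q * ?d * qcnj p"
  proof -
    have "?d = q * Z * qcnj p - q * szego q p X * qcnj p"
      using assms(3) szego_rec[OF assms(1,2), of X] by (metis add_diff_cancel_left)
    also have "\<dots> = q * ?d * qcnj p" by (simp add: left_diff_distrib right_diff_distrib)
    finally show ?thesis .
  qed
  then have "norm ?d = norm q * norm ?d * norm p" by (metis norm_mult norm_qcnj)
  also have "\<dots> \<le> norm q * norm ?d" using assms by (simp add: mult_left_le)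
  finally have "norm ?d * (1 - norm q) \<le> 0" by (simp add: algebra_simps)
  then have "norm ?d \<le> 0" using assms by (simp add: mult_le_0_iff)
  then show ?thesis by simp
qed

lemma szego_tendsto:
  assumes q: "norm q < 1" and p: "\<And>n. norm (p n) \<le> 1" "p \<longlonglongrightarrow> \<xi>" "norm \<xi> \<le> 1" and X: "X \<longlonglongrightarrow> Y"
  shows "(\<lambda>n. szego q (p n) (X n)) \<longlonglongrightarrow> szego q \<xi> Y"
proof (rule LIM_zero_cancel, rule Lim_null_comparison)
  let ?Z = "szego q \<xi> Y"
  let ?e = "\<lambda>n. norm (X n - Y) + norm q * norm ?Z * norm (p n - \<xi>)"
  show "\<forall>\<^sub>F n in sequentially. norm (szego q (p n) (X n) - ?Z) \<le> ?e n / (1 - norm q)"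
  proof (intro always_eventually allI)
    fix n
    let ?d = "szego q (p n) (X n) - ?Z"
    have "?d = (X n - Y) + q * ?d * qcnj (p n) + q * ?Z * qcnj (p n - \<xi>)"
    proof -
      have "?d = (X n + q * szego q (p n) (X n) * qcnj (p n)) - (Y + q * ?Z * qcnj \<xi>)"
        using szego_rec[OF q p(1), of n "X n"] szego_rec[OF q p(3), of Y] by metis
      also have "\<dots> = (X n - Y) + q * ?d * qcnj (p n) + q * ?Z * qcnj (p n - \<xi>)"
        by (simp add: left_diff_distrib right_diff_distrib)
      finally show ?thesis .
    qed
    then have "norm ?d = norm ((X n - Y) + q * ?d * qcnj (p n) + q * ?Z * qcnj (p n - \<xi>))"
      by (rule arg_cong)
    also have "\<dots> \<le> norm (X n - Y) + norm (q * ?d * qcnj (p n)) + norm (q * ?Z * qcnj (p n - \<xi>))"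
      by (intro norm_triangle_le add_right_mono norm_triangle_ineq)
    also have "\<dots> \<le> norm (X n - Y) + norm q * norm ?d + norm q * norm ?Z * norm (p n - \<xi>)"
      unfolding norm_mult norm_qcnj using p(1)[of n] by (simp add: mult_left_le)
    finally show "norm ?d \<le> ?e n / (1 - norm q)"
      using q by (simp add: pos_le_divide_eq algebra_simps)
  qed
  have "(\<lambda>n. ?e n / (1 - norm q)) \<longlonglongrightarrow> (norm (Y - Y) + norm q * norm ?Z * norm (\<xi> - \<xi>)) / (1 - norm q)"
    using q by (intro tendsto_intros p X) auto
  then show "(\<lambda>n. ?e n / (1 - norm q)) \<longlonglongrightarrow> 0" by simp
qed

text \<open>
  The squared norm in the Hardy space of a combination of two geometric vectors. Such vectors are
  mapped to vectors of the same form by the adjoint of multiplication.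
\<close>
lemma geometric_norm_sums:
  assumes "norm q < 1" "norm p < 1"
  shows "(\<lambda>j. (norm (qcnj (q ^ j * X) + qcnj (p ^ j * Y) * c))\<^sup>2) sums
    ((norm X)\<^sup>2 / (1 - (norm q)\<^sup>2) + (norm Y)\<^sup>2 * (norm c)\<^sup>2 / (1 - (norm p)\<^sup>2)
      + 2 * qre (szego q p (X * qcnj Y) * c))"
proof -
  have sq: "(norm q)\<^sup>2 < 1" "(norm p)\<^sup>2 < 1" using assms by (simp_all add: power_less_one_iff)
  have g: "(\<lambda>j. (r\<^sup>2) ^ j * C) sums (C / (1 - r\<^sup>2))" if "r\<^sup>2 < 1" for r C :: real
    using sums_mult2[OF geometric_sums, of "r\<^sup>2" C] that by simp
  have "(\<lambda>j. q ^ j * (X * qcnj Y) * qcnj p ^ j * c) sums (szego q p (X * qcnj Y) * c)"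
    using assms by (intro sums_mult2 szego_sums) auto
  then have k: "(\<lambda>j. 2 * qre (q ^ j * (X * qcnj Y) * qcnj p ^ j * c)) sums (2 * qre (szego q p (X * qcnj Y) * c))"
    by (intro sums_mult bounded_linear.sums[OF bounded_linear_qre])
  have "(norm (qcnj (q ^ j * X) + qcnj (p ^ j * Y) * c))\<^sup>2
     = ((norm q)\<^sup>2) ^ j * (norm X)\<^sup>2 + ((norm p)\<^sup>2) ^ j * ((norm Y)\<^sup>2 * (norm c)\<^sup>2)
       + 2 * qre (q ^ j * (X * qcnj Y) * qcnj p ^ j * c)" for j
  proof -
    have pw: "(r\<^sup>2) ^ j = (r ^ j)\<^sup>2" for r :: real by (simp flip: power_mult add: mult.commute)
    show ?thesis
      unfolding norm_add_sq norm_mult norm_qcnj norm_power pw power_mult_distrib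
      by (simp add: mult.assoc del: quat_ring_sel)
  qed
  then show ?thesis
    using sums_add[OF sums_add[OF g[OF sq(1), of "(norm X)\<^sup>2"] g[OF sq(2), of "(norm Y)\<^sup>2 * (norm c)\<^sup>2"]] k] by simp
qed

text \<open>
  A two-point Pick inequality. The adjoint of multiplication by \<open>a\<close> maps the geometric vector with
  entries \<open>qcnj (q ^ j * A)\<close> to the one with \<open>E\<close> in place of \<open>A\<close>. In particular it acts on the
  evaluation vector of a point \<open>p\<close> (the case \<open>A = 1\<close>) through the value of \<open>a\<close> at \<open>p\<close>. Its
  contractivity on the sum of the geometric vector and \<open>c\<close> times the evaluation vector of \<open>p\<close> is a
  nonnegative quadratic polynomial in \<open>c\<close>, and the claim is that its discriminant has the right sign.
  The freedom in \<open>A\<close> is what makes one inequality serve both for the Cayley transform and for the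
  values of the function itself.
\<close>
lemma two_point_inequality:
  assumes a: "ball_self_map a" and q: "norm q < 1" and p: "norm p < 1"
    and E: "(\<lambda>k. q ^ k * A * fps_nth a k) sums E"
  shows "(norm (szego q p (A - E * qcnj (peval a p))))\<^sup>2
    \<le> ((norm A)\<^sup>2 - (norm E)\<^sup>2) / (1 - (norm q)\<^sup>2) * ((1 - (norm (peval a p))\<^sup>2) / (1 - (norm p)\<^sup>2))"
proof -
  let ?P = "peval a p"
  define Z where "Z = szego q p (A - E * qcnj ?P)"
  have conv: "ball_convergent a" and bd: "\<And>q. q \<in> ball 0 1 \<Longrightarrow> norm (peval a q) < 1"
    using a by (auto simp: ball_self_map_def)
  define \<alpha> where "\<alpha> = ((norm A)\<^sup>2 - (norm E)\<^sup>2) / (1 - (norm q)\<^sup>2)"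
  define \<beta> where "\<beta> = (1 - (norm ?P)\<^sup>2) / (1 - (norm p)\<^sup>2)"
  have pos: "\<beta> > 0"
    using bd[of p] p by (auto simp: \<beta>_def power_less_one_iff intro!: divide_pos_pos)
  have D: "0 \<le> \<alpha> + \<beta> * (norm c)\<^sup>2 + 2 * qre (Z * c)" for c
  proof -
    have t: "(\<lambda>k. qcnj (fps_nth a k) * (qcnj (q ^ (j + k) * A) + qcnj (p ^ (j + k) * 1) * c)) sums
       (qcnj (q ^ j * E) + qcnj (p ^ j * ?P) * c)" for j
    proof -
      have "(\<lambda>k. qcnj (q ^ j * (q ^ k * A * fps_nth a k)) + qcnj (p ^ j * (p ^ k * fps_nth a k)) * c) sums
         (qcnj (q ^ j * E) + qcnj (p ^ j * ?P) * c)"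
        using p by (intro sums_add sums_mult2 bounded_linear.sums[OF bounded_linear_qcnj] sums_mult E peval_sums conv)
      moreover have "qcnj (q ^ j * (q ^ k * A * fps_nth a k)) + qcnj (p ^ j * (p ^ k * fps_nth a k)) * c
        = qcnj (fps_nth a k) * (qcnj (q ^ (j + k) * A) + qcnj (p ^ (j + k) * 1) * c)" for k
      proof -
        have pw: "x ^ (j + k) = x ^ k * x ^ j" for x :: quat by (simp add: power_add[symmetric] add.commute)
        have "qcnj (q ^ (j + k)) = qcnj (q ^ k) * qcnj (q ^ j)" "qcnj (p ^ (j + k)) = qcnj (p ^ k) * qcnj (p ^ j)"
          using pw[of "qcnj q"] pw[of "qcnj p"] by simp_all
        then show ?thesis
          by (simp only: qcnj_mult mult_1_right distrib_left mult.assoc)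
      qed
      ultimately show ?thesis by simp
    qed
    have "(norm E)\<^sup>2 / (1 - (norm q)\<^sup>2) + (norm ?P)\<^sup>2 * (norm c)\<^sup>2 / (1 - (norm p)\<^sup>2)
        + 2 * qre (szego q p (E * qcnj ?P) * c)
      \<le> (norm A)\<^sup>2 / (1 - (norm q)\<^sup>2) + (norm (1::quat))\<^sup>2 * (norm c)\<^sup>2 / (1 - (norm p)\<^sup>2)
        + 2 * qre (szego q p (A * qcnj 1) * c)"
      by (rule toeplitz_adjoint_contraction_l2[OF peval_sums[OF conv] less_imp_le[OF bd] t
            geometric_norm_sums[OF q p] geometric_norm_sums[OF q p]]) auto
    moreover have "qre (Z * c) = qre (szego q p A * c) - qre (szego q p (E * qcnj ?P) * c)"
      using p by (simp add: Z_def szego_diff[OF q] left_diff_distrib del: quat_ring_sel(20))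
    ultimately show ?thesis
      by (simp add: \<alpha>_def \<beta>_def diff_divide_distrib left_diff_distrib del: quat_ring_sel)
  qed
  \<comment> \<open>the quadratic polynomial at its minimum\<close>
  have "0 \<le> \<alpha> + \<beta> * (norm (- (1 / \<beta>) *\<^sub>R qcnj Z))\<^sup>2 + 2 * qre (Z * (- (1 / \<beta>) *\<^sub>R qcnj Z))"
    by (rule D)
  also have "qre (Z * (- (1 / \<beta>) *\<^sub>R qcnj Z)) = - (1 / \<beta>) * (norm Z)\<^sup>2"
    by (simp only: mult_scaleR_right mult_qcnj quat_scaleR_sel qre_simps)
  also have "\<beta> * (norm (- (1 / \<beta>) *\<^sub>R qcnj Z))\<^sup>2 = (norm Z)\<^sup>2 / \<beta>"
    using pos by (simp add: power_mult_distrib power2_eq_square)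
  finally have "(norm Z)\<^sup>2 / \<beta> \<le> \<alpha>" by simp
  then show ?thesis
    using pos by (simp add: Z_def \<alpha>_def \<beta>_def[symmetric] pos_divide_le_eq)
qed

text \<open>
  Let the second point of the Pick inequality tend to the boundary point \<open>\<xi>\<close> along the given
  sequence: its value becomes 1, its defect quotient becomes \<open>\<alpha>\<close>, and the kernel is continuous up to
  \<open>\<xi>\<close> because \<open>q\<close> stays inside the ball.
\<close>
lemma boundary_inequality:
  assumes a: "ball_self_map a" and q: "norm q < 1" and E: "(\<lambda>k. q ^ k * A * fps_nth a k) sums E"
    and p: "\<And>n. norm (p n) < 1" "p \<longlonglongrightarrow> \<xi>" "norm \<xi> = 1" and lim: "(\<lambda>n. peval a (p n)) \<longlonglongrightarrow> 1"
    and \<alpha>: "(\<lambda>n. (1 - (norm (peval a (p n)))\<^sup>2) / (1 - (norm (p n))\<^sup>2)) \<longlonglongrightarrow> \<alpha>"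
  shows "(norm (szego q \<xi> (A - E)))\<^sup>2 * (1 - (norm q)\<^sup>2) \<le> \<alpha> * ((norm A)\<^sup>2 - (norm E)\<^sup>2)"
proof -
  have "(\<lambda>n. A - E * qcnj (peval a (p n))) \<longlonglongrightarrow> A - E * qcnj 1"
    by (intro tendsto_intros bounded_linear.tendsto[OF bounded_linear_qcnj] lim)
  then have "(\<lambda>n. szego q (p n) (A - E * qcnj (peval a (p n)))) \<longlonglongrightarrow> szego q \<xi> (A - E)"
    using p by (intro szego_tendsto q) (auto intro: less_imp_le)
  then have "(\<lambda>n. (norm (szego q (p n) (A - E * qcnj (peval a (p n)))))\<^sup>2) \<longlonglongrightarrow> (norm (szego q \<xi> (A - E)))\<^sup>2"
    by (intro tendsto_intros)
  moreover have "(\<lambda>n. ((norm A)\<^sup>2 - (norm E)\<^sup>2) / (1 - (norm q)\<^sup>2) * ((1 - (norm (peval a (p n)))\<^sup>2) / (1 - (norm (p n))\<^sup>2)))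
    \<longlonglongrightarrow> ((norm A)\<^sup>2 - (norm E)\<^sup>2) / (1 - (norm q)\<^sup>2) * \<alpha>"
    by (intro tendsto_intros \<alpha>)
  ultimately have "(norm (szego q \<xi> (A - E)))\<^sup>2 \<le> ((norm A)\<^sup>2 - (norm E)\<^sup>2) / (1 - (norm q)\<^sup>2) * \<alpha>"
    by (rule LIMSEQ_le) (use two_point_inequality[OF a q p(1) E] in auto)
  moreover have "(norm q)\<^sup>2 < 1" using q by (simp add: power_less_one_iff)
  ultimately show ?thesis by (simp add: pos_le_divide_eq mult.commute)
qed

text \<open>
  The functions \<open>q * qcnj u\<close> occur with \<open>norm u = 1\<close> on the right-hand side of the Julia inequality and
  with \<open>norm u < 1\<close> in Moebius transformations.
\<close>
lemma ball_self_map_linear: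
  assumes "norm u \<le> 1"
  shows "ball_self_map (fps_X * fps_const (qcnj u))"
    and "norm q < 1 \<Longrightarrow> peval (fps_X * fps_const (qcnj u)) q = q * qcnj u"
proof -
  have ev: "peval (fps_X * fps_const (qcnj u)) q = q * qcnj u" if "norm q < 1" for q
    using peval_mult_const[OF ball_convergent_X that] unfolding peval_X .
  then show "norm q < 1 \<Longrightarrow> peval (fps_X * fps_const (qcnj u)) q = q * qcnj u" .
  show "ball_self_map (fps_X * fps_const (qcnj u))"
    unfolding ball_self_map_def
  proof (intro conjI ballI)
    show "ball_convergent (fps_X * fps_const (qcnj u))"
      by (rule ball_convergent_mult_const[OF ball_convergent_X])
    show "norm (peval (fps_X * fps_const (qcnj u)) q) < 1" if "q \<in> ball 0 1" for q
      using that mult_left_le[OF assms norm_ge_zero[of q]] by (subst ev) (auto simp: norm_mult)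
  qed
qed

lemma peval_rotation_resolvent:
  assumes \<xi>: "norm \<xi> = 1" and q: "norm q < 1"
  shows "peval (inverse (1 - fps_X * fps_const (qcnj \<xi>))) q = szego q \<xi> 1"
proof (rule szego_unique[OF q])
  let ?a = "fps_X * fps_const (qcnj \<xi>)" let ?L = "inverse (1 - ?a)"
  note a = ball_self_map_linear(1)[OF eq_refl[OF \<xi>]]
  note conv = ball_convergent_inverse_one_minus[OF a]
  have "?L = 1 + ?L * ?a" using inverse_one_minus(3)[OF a] by simp
  also have "?L * ?a = (fps_X * ?L) * fps_const (qcnj \<xi>)"
    by (metis fps_mult_fps_X_commute mult.assoc)
  finally have "peval ?L q = peval (1 + (fps_X * ?L) * fps_const (qcnj \<xi>)) q" by (rule arg_cong)
  then show "peval ?L q = 1 + q * peval ?L q * qcnj \<xi>"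
    using q conv by (simp add: peval_add ball_convergent_mult_const ball_convergent_mult peval_mult_const peval_X_mult)
qed (use \<xi> in auto)

text \<open>
  The right-hand side of the Julia inequality, a Poisson kernel with pole \<open>\<xi>\<close>. It equals
  \<open>1 - (norm q)\<^sup>2\<close> times the quantity \<open>(norm (szego q \<xi> 1))\<^sup>2\<close> bounded in \<open>boundary_inequality\<close> when
  \<open>A - E = 1\<close>.
\<close>
lemma qre_cayley_rotation:
  assumes \<xi>: "norm \<xi> = 1" and q: "norm q < 1"
  shows "qre (regular_cayley (\<lambda>q. q * qcnj \<xi>) q) = (1 - (norm q)\<^sup>2) * (norm (szego q \<xi> 1))\<^sup>2"
proof -
  let ?s = "szego q \<xi> 1"
  have "regular_cayley (\<lambda>q. q * qcnj \<xi>) q = 2 * ?s - 1"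
    using regular_cayley_eq[OF ball_self_map_linear(1)[OF eq_refl[OF \<xi>]], of "\<lambda>q. q * qcnj \<xi>" q] q
    by (simp add: ball_self_map_linear(2)[OF eq_refl[OF \<xi>]] peval_rotation_resolvent[OF \<xi> q])
  moreover have "?s - 1 = q * ?s * qcnj \<xi>"
    using szego_rec[OF q, of \<xi> 1] \<xi> by (metis add_diff_cancel_left' order_refl)
  then have "norm (?s - 1) = norm q * norm ?s" using \<xi> by (simp add: norm_mult)
  ultimately show ?thesis
    by (simp add: qre_two_minus_one power_mult_distrib left_diff_distrib del: quat_ring_sel)
qed

text \<open>
  For \<open>A\<close> the value of the resolvent, the vector in the Pick inequality has \<open>E = A - 1\<close>, because
  \<open>inverse (1 - a) * a = inverse (1 - a) - 1\<close>.
\<close>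
lemma resolvent_sums:
  assumes a: "ball_self_map a" and q: "norm q < 1"
  shows "(\<lambda>k. q ^ k * peval (inverse (1 - a)) q * fps_nth a k) sums (peval (inverse (1 - a)) q - 1)"
proof -
  note conv = ball_convergent_inverse_one_minus[OF a]
  have "(\<lambda>k. q ^ k * peval (inverse (1 - a)) q * fps_nth a k) sums peval (inverse (1 - a) * a) q"
    using a by (intro peval_mult conv q) (auto simp: ball_self_map_def)
  then show ?thesis
    using q conv by (simp add: inverse_one_minus(3)[OF a] peval_diff)
qed

section \<open>Power series expansion of slice regular functions\<close>

definition slice_embed :: "quat \<Rightarrow> complex \<Rightarrow> quat"
  where "slice_embed I z = of_real (Re z) + of_real (Im z) * I"

text \<open>
  The complex-linear functional for the left action of the slice of \<open>I\<close>. Composed with right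
  multiplications by arbitrary \<open>c\<close>, it recovers all components of a quaternion.
\<close>
definition slice_coord :: "quat \<Rightarrow> quat \<Rightarrow> complex"
  where "slice_coord I w = Complex (qre w) (- qre (I * w))"

lemma slice_embed_mult:
  assumes "I \<in> quat_S"
  shows "slice_embed I (z * w) = slice_embed I z * slice_embed I w"
proof -
  have II: "I * I = - 1" using assms by (simp add: quat_S_def power2_eq_square)
  have "(of_real c + of_real s * I) * (of_real a + of_real b * I)
     = of_real (c * a - s * b) + of_real (c * b + s * a) * I" for a b c s :: real
    using II unfolding of_real_def by (simp add: algebra_simps)
  then show ?thesis unfolding slice_embed_def by simp
qed

lemma slice_embed_simps [simp]: "slice_embed I 0 = 0" "slice_embed I 1 = 1" "slice_embed I (of_real x) = of_real x"
  by (simp_all add: slice_embed_def)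

lemma slice_embed_power: "I \<in> quat_S \<Longrightarrow> slice_embed I (z ^ n) = slice_embed I z ^ n"
  by (induction n) (simp_all add: slice_embed_mult)

lemma norm_slice_embed [simp]:
  assumes "I \<in> quat_S" shows "norm (slice_embed I z) = cmod z"
proof -
  have "(norm (slice_embed I z))\<^sup>2 = (cmod z)\<^sup>2"
    using assms by (simp add: slice_embed_def norm_add_sq quat_S_iff norm_mult cmod_power2)
  then show ?thesis by simp
qed

lemma bounded_linear_slice_embed:
  assumes "I \<in> quat_S" shows "bounded_linear (slice_embed I)"
  by (rule bounded_linear_intro[where K=1])
     (use assms in \<open>simp_all add: slice_embed_def algebra_simps scaleR_conv_of_real norm_slice_embed[unfolded slice_embed_def]\<close>)

lemma slice_coord_mult:
  assumes "I \<in> quat_S"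
  shows "slice_coord I (slice_embed I z * w) = z * slice_coord I w"
proof -
  have "I * (I * w) = - w"
    using assms by (simp add: quat_S_def power2_eq_square mult.assoc[symmetric])
  then show ?thesis
    unfolding slice_coord_def slice_embed_def scaleR_conv_of_real[symmetric]
    by (simp add: complex_eq_iff distrib_right distrib_left flip: scaleR_conv_of_real)
      (simp add: algebra_simps)
qed

lemma bounded_linear_slice_coord:
  assumes "I \<in> quat_S" shows "bounded_linear (slice_coord I)"
proof (rule bounded_linear_intro[where K=2])
  show "slice_coord I (x + y) = slice_coord I x + slice_coord I y"
    "slice_coord I (r *\<^sub>R x) = r *\<^sub>R slice_coord I x" for x y r
    by (simp_all add: slice_coord_def complex_eq_iff algebra_simps)
  show "cmod (slice_coord I x) \<le> norm x * 2" for x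
  proof -
    have "cmod (slice_coord I x) \<le> \<bar>qre x\<bar> + \<bar>- qre (I * x)\<bar>"
      using cmod_le[of "slice_coord I x"] unfolding slice_coord_def by simp
    also have "\<dots> \<le> norm x + norm (I * x)"
      using abs_qre_le_norm[of x] abs_qre_le_norm[of "I * x"] by linarith
    finally show ?thesis using assms by (simp add: norm_mult quat_S_iff)
  qed
qed

lemma slice_coord_peval_holomorphic:
  assumes I: "I \<in> quat_S" and a: "ball_convergent a"
  shows "(\<lambda>z. slice_coord I (peval a (slice_embed I z) * c)) holomorphic_on ball 0 1"
proof (rule power_series_holomorphic)
  fix z :: complex assume "z \<in> ball 0 1"
  then have "(\<lambda>n. slice_coord I (slice_embed I z ^ n * fps_nth a n * c)) sums slice_coord I (peval a (slice_embed I z) * c)"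
    using I by (intro bounded_linear.sums[OF bounded_linear_slice_coord[OF I]] sums_mult2 peval_sums a) simp
  moreover have "slice_coord I (slice_embed I z ^ n * fps_nth a n * c) = slice_coord I (fps_nth a n * c) * (z - 0) ^ n" for n
    using I by (simp add: mult.assoc slice_coord_mult flip: slice_embed_power)
  ultimately show "(\<lambda>n. slice_coord I (fps_nth a n * c) * (z - 0) ^ n) sums slice_coord I (peval a (slice_embed I z) * c)"
    by simp
qed

text \<open>
  The differential equation defining slice regularity becomes the Cauchy-Riemann equation for every
  component. Continuity of the partial derivatives gives total differentiability, which is checked
  on a small square inside the disc.
\<close>
lemma slice_coord_slice_regular_holomorphic:
  assumes f: "slice_regular_on (ball 0 1) f" and I: "I \<in> quat_S"
  shows "(\<lambda>z. slice_coord I (f (slice_embed I z) * c)) holomorphic_on ball 0 1"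
proof -
  let ?D = "{(x, y). of_real x + of_real y * I \<in> ball 0 1}"
  define \<phi> where "\<phi> w = slice_coord I (w * c)" for w
  have \<phi>: "bounded_linear \<phi>"
    unfolding \<phi>_def by (intro bounded_linear_compose[OF bounded_linear_slice_coord[OF I]] bounded_linear_mult_left)
  from f I obtain fx fy where "continuous_on ?D fy"
    and der: "\<And>x y. (x, y) \<in> ?D \<Longrightarrow> ((\<lambda>t. f (of_real t + of_real y * I)) has_vector_derivative fx (x, y)) (at x)
            \<and> ((\<lambda>t. f (of_real x + of_real t * I)) has_vector_derivative fy (x, y)) (at y)
            \<and> (1/2) *\<^sub>R (fx (x, y) + I * fy (x, y)) = 0"
    unfolding slice_regular_on_def Let_def by fastforce
  then have fy_cont: "continuous_on ?D fy" by simp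
  define G where "G x y = \<phi> (f (of_real x + of_real y * I))" for x y
  have "\<exists>F'. ((\<lambda>z. \<phi> (f (slice_embed I z))) has_field_derivative F') (at z0)" if z0: "z0 \<in> ball 0 1" for z0
  proof -
    define x0 y0 where "x0 = Re z0" and "y0 = Im z0"
    define e where "e = (1 - cmod z0) / 2"
    define X Y where "X = ball x0 e" and "Y = ball y0 e"
    have e: "e > 0" using z0 by (simp add: e_def)
    have XY: "X \<times> Y \<subseteq> ?D"
    proof safe
      fix x y assume "x \<in> X" "y \<in> Y"
      then have "\<bar>x - x0\<bar> + \<bar>y - y0\<bar> < 2 * e" by (simp add: X_def Y_def dist_real_def)
      then have "cmod (Complex x y - z0) < 2 * e"
        using cmod_le[of "Complex x y - z0"] by (simp add: x0_def y0_def)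
      then have "cmod (Complex x y) < 1"
        using norm_triangle_sub[of "Complex x y" z0] by (simp add: e_def)
      then show "of_real x + of_real y * I \<in> ball 0 1"
        using norm_slice_embed[OF I, of "Complex x y"] by (simp add: slice_embed_def)
    qed
    have mem: "x0 \<in> X" "y0 \<in> Y" using e by (simp_all add: X_def Y_def)
    have "((\<lambda>(x, y). G x y) has_derivative
        (\<lambda>(tx, ty). tx *\<^sub>R \<phi> (fx (x0, y0)) + blinfun_scaleR_left (\<phi> (fy (x0, y0))) ty)) (at (x0, y0) within X \<times> Y)"
    proof (rule has_derivative_partialsI)
      show "((\<lambda>x. G x y0) has_derivative (\<lambda>tx. tx *\<^sub>R \<phi> (fx (x0, y0)))) (at x0 within X)"
      proof -
        have "((\<lambda>x. G x y0) has_vector_derivative \<phi> (fx (x0, y0))) (at x0 within X)"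
          unfolding G_def
          by (rule has_vector_derivative_at_within, rule bounded_linear.has_vector_derivative[OF \<phi>])
             (use der[of x0 y0] mem XY in blast)
        then show ?thesis by (simp add: has_vector_derivative_def)
      qed
      show "((\<lambda>y. G x y) has_derivative blinfun_apply (blinfun_scaleR_left (\<phi> (fy (x, y))))) (at y within Y)"
        if "x \<in> X" "y \<in> Y" for x y
      proof -
        have "((\<lambda>y. G x y) has_vector_derivative \<phi> (fy (x, y))) (at y within Y)"
          unfolding G_def
          by (rule has_vector_derivative_at_within, rule bounded_linear.has_vector_derivative[OF \<phi>])
             (use der[of x y] that XY in blast)
        then show ?thesis by (simp add: has_vector_derivative_def)
      qed
      have "continuous_on (X \<times> Y) (\<lambda>p. blinfun_scaleR_left (\<phi> (fy p)))"
        by (intro bounded_linear.continuous_on[OF bounded_linear_blinfun_scaleR_left]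
            bounded_linear.continuous_on[OF \<phi>] continuous_on_subset[OF fy_cont XY])
      then show "continuous (at (x0, y0) within X \<times> Y) (\<lambda>(x, y). blinfun_scaleR_left (\<phi> (fy (x, y))))"
        using mem by (simp add: continuous_on_eq_continuous_within case_prod_unfold)
    qed (use mem in \<open>auto simp: Y_def\<close>)
    moreover have "at (x0, y0) within X \<times> Y = at (x0, y0)"
      using mem by (intro at_within_open) (auto simp: X_def Y_def open_Times)
    ultimately have G': "((\<lambda>(x, y). G x y) has_derivative
        (\<lambda>(tx, ty). tx *\<^sub>R \<phi> (fx (x0, y0)) + ty *\<^sub>R \<phi> (fy (x0, y0)))) (at (Re z0, Im z0))"
      by (simp add: x0_def y0_def)
    have "((\<lambda>z. (Re z, Im z)) has_derivative (\<lambda>h. (Re h, Im h))) (at z0)"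
      by (intro has_derivative_Pair bounded_linear_imp_has_derivative bounded_linear_Re bounded_linear_Im)
    from diff_chain_at[OF this G']
    have "((\<lambda>z. \<phi> (f (slice_embed I z))) has_derivative
        (\<lambda>h. Re h *\<^sub>R \<phi> (fx (x0, y0)) + Im h *\<^sub>R \<phi> (fy (x0, y0)))) (at z0)"
      by (simp add: o_def G_def slice_embed_def)
    moreover have "\<phi> (fy (x0, y0)) = \<i> * \<phi> (fx (x0, y0))"
    proof -
      have "fx (x0, y0) = - (I * fy (x0, y0))"
        proof -
        have "(x0, y0) \<in> ?D" using mem XY by blast
        then have "(1/2) *\<^sub>R (fx (x0, y0) + I * fy (x0, y0)) = 0" using der by blast
        then show ?thesis by (simp add: eq_neg_iff_add_eq_0)
      qed
      then have "I * fx (x0, y0) = fy (x0, y0)"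
        using I by (simp add: quat_S_def power2_eq_square mult.assoc[symmetric])
      moreover have "slice_embed I \<i> = I" by (simp add: slice_embed_def)
      ultimately show ?thesis
        using slice_coord_mult[OF I, of \<i> "fx (x0, y0) * c"] by (simp add: \<phi>_def mult.assoc[symmetric])
    qed
    moreover have "Re h *\<^sub>R w + Im h *\<^sub>R (\<i> * w) = w * h" for h w
      by (simp add: complex_eq_iff algebra_simps)
    ultimately have "((\<lambda>z. \<phi> (f (slice_embed I z))) has_derivative (*) (\<phi> (fx (x0, y0)))) (at z0)"
      by simp
    then show ?thesis by (auto simp: has_field_derivative_def)
  qed
  then show ?thesis
    unfolding \<phi>_def by (subst holomorphic_on_open) auto
qed

text \<open>
  The splitting lemma on the slice of \<open>I = i\<close>: writing \<open>w = F + G * J\<close> with \<open>J = j\<close> and \<open>F\<close>, \<open>G\<close> in the slice,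
  both parts are holomorphic. Their Taylor coefficients combine to quaternionic
  coefficients that represent \<open>f\<close> on the real axis.
\<close>
lemma slice_regular_base_expansion:
  assumes f: "slice_regular_on (ball 0 1) f"
  shows "\<exists>a. \<forall>x::real. \<bar>x\<bar> < 1 \<longrightarrow> (\<lambda>n. of_real x ^ n * fps_nth a n) sums f (of_real x)"
proof -
  define I J where "I = Quat 0 1 0 0" and "J = Quat 0 0 1 0"
  have I: "I \<in> quat_S" by (simp add: I_def quat_S_iff norm_quat_def)
  let ?F = "\<lambda>c z. slice_coord I (f (slice_embed I z) * c)"
  let ?\<alpha> = "\<lambda>c n. (deriv ^^ n) (?F c) 0 / fact n"
  define a where "a = Abs_fps (\<lambda>n. slice_embed I (?\<alpha> 1 n) + slice_embed I (?\<alpha> (- J) n) * J)"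
  have split: "w = slice_embed I (slice_coord I (w * 1)) + slice_embed I (slice_coord I (w * - J)) * J" for w
    by (simp add: slice_embed_def slice_coord_def I_def J_def quat_eq_iff)
  have "(\<lambda>n. of_real x ^ n * fps_nth a n) sums f (of_real x)" if "\<bar>x\<bar> < 1" for x :: real
  proof -
    let ?z = "of_real x :: complex"
    have s: "(\<lambda>n. slice_embed I (?\<alpha> c n * (?z - 0) ^ n)) sums slice_embed I (?F c ?z)" for c
      using that
      by (intro bounded_linear.sums[OF bounded_linear_slice_embed[OF I]] holomorphic_power_series[where r=1]
          slice_coord_slice_regular_holomorphic f I) simp
    have "(\<lambda>n. slice_embed I (?\<alpha> 1 n * (?z - 0) ^ n) + slice_embed I (?\<alpha> (- J) n * (?z - 0) ^ n) * J) sums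
        (slice_embed I (?F 1 ?z) + slice_embed I (?F (- J) ?z) * J)"
      by (intro sums_add sums_mult2 s)
    moreover have "slice_embed I (\<alpha> * (?z - 0) ^ n) = of_real x ^ n * slice_embed I \<alpha>" for \<alpha> n
      using slice_embed_mult[OF I, of "?z ^ n" \<alpha>] slice_embed_power[OF I, of ?z n] by (simp add: mult.commute)
    then have "of_real x ^ n * fps_nth a n
        = slice_embed I (?\<alpha> 1 n * (?z - 0) ^ n) + slice_embed I (?\<alpha> (- J) n * (?z - 0) ^ n) * J" for n
      by (simp only: a_def fps_nth_Abs_fps distrib_left mult.assoc)
    moreover have "slice_embed I (?F 1 ?z) + slice_embed I (?F (- J) ?z) * J = f (of_real x)"
      using split[of "f (of_real x)"] by simp
    ultimately show ?thesis by (simp only:)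
  qed
  then show ?thesis by blast
qed

text \<open>
  All slices meet in the real axis, so the coefficients found on one slice represent \<open>f\<close> on every
  other slice by the identity theorem.
\<close>
theorem slice_regular_expansion:
  assumes f: "slice_regular_on (ball 0 1) f"
  shows "\<exists>a. ball_convergent a \<and> (\<forall>q\<in>ball 0 1. f q = peval a q)"
proof -
  obtain a where a: "\<And>x::real. \<bar>x\<bar> < 1 \<Longrightarrow> (\<lambda>n. of_real x ^ n * fps_nth a n) sums f (of_real x)"
    using slice_regular_base_expansion[OF f] by blast
  have conv: "ball_convergent a"
    unfolding ball_convergent_def using expansion_abs_summable[of "fps_nth a"] a by (auto simp: sums_iff)
  have real: "f (of_real x) = peval a (of_real x)" if "\<bar>x\<bar> < 1" for x :: real
    using sums_unique2[OF a[OF that] peval_sums[OF conv]] that by simp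
  have "f q = peval a q" if q: "q \<in> ball 0 1" for q
  proof -
    obtain I where I: "I \<in> quat_S" "q = of_real (qre q) + of_real (norm (qim q)) * I"
      using quat_in_slice by blast
    define z where "z = Complex (qre q) (norm (qim q))"
    have qz: "q = slice_embed I z" using I(2) by (simp add: slice_embed_def z_def)
    have z: "z \<in> ball 0 1" using q norm_slice_embed[OF I(1), of z] by (simp add: qz)
    have eq: "slice_coord I (f (slice_embed I z) * c) - slice_coord I (peval a (slice_embed I z) * c) = 0" for c
    proof (rule analytic_continuation[where S = "ball 0 1" and U = "of_real ` {-1<..<1::real}" and \<xi> = 0
          and w = z and f = "\<lambda>z. slice_coord I (f (slice_embed I z) * c) - slice_coord I (peval a (slice_embed I z) * c)"])
      show "(\<lambda>z. slice_coord I (f (slice_embed I z) * c) - slice_coord I (peval a (slice_embed I z) * c)) holomorphic_on ball 0 1"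
        by (intro holomorphic_on_diff slice_coord_slice_regular_holomorphic f I slice_coord_peval_holomorphic conv)
      show "(0::complex) islimpt of_real ` {-1<..<1::real}"
        unfolding islimpt_approachable
      proof safe
        fix e :: real assume e: "e > 0"
        let ?x = "min (e / 2) (1 / 2)"
        show "\<exists>x'\<in>of_real ` {-1<..<1::real}. x' \<noteq> (0::complex) \<and> dist x' 0 < e"
          by (rule bexI[of _ "of_real ?x"]) (use e in auto)
      qed
    qed (use z real in auto)
    let ?d = "f q - peval a q"
    have "Re (slice_coord I (?d * c)) = 0" for c
      using eq[of c] linear_diff[OF bounded_linear.linear[OF bounded_linear_slice_coord[OF I(1)]], of "f q * c" "peval a q * c"]
      by (simp add: qz[symmetric] left_diff_distrib)
    then have "qre (?d * qcnj ?d) = 0" by (simp add: slice_coord_def del: quat_ring_sel)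
    then have "(norm ?d)\<^sup>2 = 0" by (simp only: mult_qcnj qre_simps)
    then show ?thesis by simp
  qed
  then show ?thesis using conv by blast
qed

section \<open>Regular Moebius transformations\<close>

lemma peval_regular_inverse_product:
  assumes u: "norm u \<le> 1"
  shows "(regular_recip (\<lambda>q. 1 - q * qcnj u) \<star> (\<lambda>q. (q - u) * v)) q
    = peval (inverse (1 - fps_X * fps_const (qcnj u)) * ((fps_X - fps_const u) * fps_const v)) q"
proof -
  let ?c = "fps_X * fps_const (qcnj u)"
  note c = ball_self_map_linear[OF u]
  have conv: "ball_convergent ?c" "ball_convergent (1 - ?c)" "ball_convergent (inverse (1 - ?c))"
    "ball_convergent (fps_X - fps_const u)" "ball_convergent ((fps_X - fps_const u) * fps_const v)"
    using c(1) ball_convergent_inverse_one_minus[OF c(1)]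
    by (auto simp: ball_self_map_def intro!: ball_convergent_diff ball_convergent_mult_const)
  have 1: "regular_coeffs (\<lambda>q. 1 - q * qcnj u) = fps_nth (1 - ?c)"
    by (rule regular_coeffs_peval[OF conv(2)]) (subst peval_diff, use conv c(2) in auto)
  have 2: "regular_coeffs (regular_recip (\<lambda>q. 1 - q * qcnj u)) = fps_nth (inverse (1 - ?c))"
    by (rule regular_coeffs_peval[OF conv(3)], rule regular_recip_peval[OF 1 conv(2)])
       (use inverse_one_minus[OF c(1)] conv in auto)
  have 3: "regular_coeffs (\<lambda>q. (q - u) * v) = fps_nth ((fps_X - fps_const u) * fps_const v)"
    by (rule regular_coeffs_peval[OF conv(5)])
       (simp add: peval_mult_const[OF conv(4)] peval_diff)
  show ?thesis by (rule regular_mult_peval[OF 2 3])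
qed

text \<open>
  Clearing the regular reciprocal turns the definition into a linear equation for the power series.
\<close>
lemma regular_moebius_iff:
  assumes a: "ball_convergent a" and f: "\<And>q. q \<in> ball 0 1 \<Longrightarrow> f q = peval a q"
  shows "regular_moebius f \<longleftrightarrow> (\<exists>u v. norm u < 1 \<and> norm v = 1 \<and>
    (1 - fps_X * fps_const (qcnj u)) * a = (fps_X - fps_const u) * fps_const v)"
    (is "_ \<longleftrightarrow> (\<exists>u v. ?P u v)")
proof
  assume "regular_moebius f"
  then obtain u v where u: "norm u < 1" and v: "norm v = 1"
    and fq: "\<And>q. q \<in> ball 0 1 \<Longrightarrow> f q = (regular_recip (\<lambda>q. 1 - q * qcnj u) \<star> (\<lambda>q. (q - u) * v)) q"
    by (auto simp: regular_moebius_def)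
  let ?R = "inverse (1 - fps_X * fps_const (qcnj u))" and ?g = "(fps_X - fps_const u) * fps_const v"
  note c = ball_self_map_linear[OF less_imp_le[OF u]]
  have "ball_convergent (?R * ?g)"
    by (intro ball_convergent_mult ball_convergent_inverse_one_minus c ball_convergent_diff) auto
  then have "regular_coeffs f = fps_nth (?R * ?g)"
    by (rule regular_coeffs_peval) (use fq peval_regular_inverse_product[OF less_imp_le[OF u]] in simp)
  then have "a = ?R * ?g"
    using regular_coeffs_peval[OF a f] by (simp add: fps_nth_inject)
  then have "(1 - fps_X * fps_const (qcnj u)) * a = ?g"
    using inverse_one_minus(2)[OF c(1)] by (simp only: mult.assoc[symmetric] mult_1_left)
  then show "\<exists>u v. ?P u v" using u v by blast
next
  assume "\<exists>u v. ?P u v"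
  then obtain u v where u: "norm u < 1" and v: "norm v = 1"
    and eq: "(1 - fps_X * fps_const (qcnj u)) * a = (fps_X - fps_const u) * fps_const v" by blast
  note c = ball_self_map_linear[OF less_imp_le[OF u]]
  have "a = inverse (1 - fps_X * fps_const (qcnj u)) * ((fps_X - fps_const u) * fps_const v)"
    unfolding eq[symmetric] using inverse_one_minus(1)[OF c(1)] by (simp only: mult.assoc[symmetric] mult_1_left)
  then show "regular_moebius f"
    unfolding regular_moebius_def using u v f
    by (intro bexI[of _ u] bexI[of _ v]) (auto simp: peval_regular_inverse_product[OF less_imp_le[OF u]])
qed

section \<open>Rigidity\<close>

text \<open>
  An open image cannot touch the boundary of the right half-plane.
\<close>
lemma holomorphic_Re_nonneg_constant:
  assumes g: "g holomorphic_on ball 0 1" and pos: "\<And>z. z \<in> ball 0 1 \<Longrightarrow> 0 \<le> Re (g z)"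
    and z0: "z0 \<in> ball 0 1" "Re (g z0) = 0" and z: "z \<in> ball 0 1"
  shows "g z = g z0"
proof -
  have "g constant_on ball 0 1"
  proof (rule ccontr)
    assume "\<not> g constant_on ball 0 1"
    then have "open (g ` ball 0 1)"
      using open_mapping_thm[OF g open_ball connected_ball open_ball subset_refl] by blast
    then obtain e where e: "e > 0" "ball (g z0) e \<subseteq> g ` ball 0 1"
      using z0(1) by (meson imageI open_contains_ball)
    have "g z0 - of_real (e / 2) \<in> ball (g z0) e" using e(1) by (simp add: dist_norm)
    then obtain w where "w \<in> ball 0 1" "g z0 - of_real (e / 2) = g w" using e(2) by blast
    then have "0 \<le> Re (g z0 - of_real (e / 2))" using pos by metis
    then show False using z0(2) e(1) by simp
  qed
  then show ?thesis using z0 z unfolding constant_on_def by metis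
qed

text \<open>
  One zero of the real part forces constancy on the slice of \<open>q0\<close>, hence a zero of the real part at
  the origin, which belongs to every slice. Constancy of \<open>slice_coord I\<close> on all slices then leaves
  only the constant coefficient.
\<close>
lemma qre_nonneg_zero_constant:
  assumes m: "ball_convergent m" and pos: "\<And>q. q \<in> ball 0 1 \<Longrightarrow> 0 \<le> qre (peval m q)"
    and q0: "q0 \<in> ball 0 1" "qre (peval m q0) = 0"
  shows "m = fps_const (fps_nth m 0) \<and> qre (fps_nth m 0) = 0"
proof -
  let ?g = "\<lambda>I z. slice_coord I (peval m (slice_embed I z) * 1)"
  have const: "?g I z = ?g I z0"
    if I: "I \<in> quat_S" and z0: "z0 \<in> ball 0 1" "qre (peval m (slice_embed I z0)) = 0" and z: "z \<in> ball 0 1" for I z z0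
    by (rule holomorphic_Re_nonneg_constant[OF slice_coord_peval_holomorphic[OF I m, of 1] _ z0(1) _ z])
       (use I pos z0 in \<open>auto simp: slice_coord_def\<close>)
  obtain I where I: "I \<in> quat_S" "q0 = of_real (qre q0) + of_real (norm (qim q0)) * I"
    using quat_in_slice by blast
  define z0 where "z0 = Complex (qre q0) (norm (qim q0))"
  have qz: "q0 = slice_embed I z0" using I(2) by (simp add: slice_embed_def z0_def)
  have "z0 \<in> ball 0 1" using q0(1) I(1) by (simp add: qz)
  then have "?g I 0 = ?g I z0" using q0(2) by (intro const I) (simp_all add: qz)
  then have m0: "qre (fps_nth m 0) = 0"
    using arg_cong[of _ _ Re] q0(2) by (fastforce simp: slice_coord_def peval_0 qz)
  have real: "peval m (of_real x) = fps_nth m 0" if x: "\<bar>x\<bar> < 1" for x :: real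
  proof -
    have *: "qre (peval m (of_real x)) = qre (fps_nth m 0) \<and>
        qre (I * peval m (of_real x)) = qre (I * fps_nth m 0)" if "I \<in> quat_S" for I
      using const[OF that, of 0 "of_real x"] m0 x by (simp add: slice_coord_def peval_0 del: quat_ring_sel)
    have "Quat 0 1 0 0 \<in> quat_S" "Quat 0 0 1 0 \<in> quat_S" "Quat 0 0 0 1 \<in> quat_S"
      by (simp_all add: quat_S_iff norm_quat_def)
    from this[THEN *] show ?thesis by (simp add: quat_eq_iff)
  qed
  have "fps_nth m n = 0" if "n \<noteq> 0" for n
  proof -
    have "(if n = 0 then 0 else fps_nth m n \<bullet> e) = 0" for e
    proof (rule powser_real_sums_zero[of "\<lambda>n. if n = 0 then 0 else fps_nth m n \<bullet> e"])
      fix x :: real assume "norm x < 1"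
      then have x: "\<bar>x\<bar> < 1" by simp
      have "(\<lambda>n. (of_real x ^ n * fps_nth m n) \<bullet> e) sums (peval m (of_real x) \<bullet> e)"
        using x by (intro bounded_linear.sums[OF bounded_linear_inner_left] peval_sums m) simp
      moreover have "(of_real x ^ n * fps_nth m n) \<bullet> e = fps_nth m n \<bullet> e * x ^ n" for n
        by (metis inner_scaleR_left mult.commute of_real_power scaleR_conv_of_real)
      ultimately have "(\<lambda>n. fps_nth m n \<bullet> e * x ^ n) sums (fps_nth m 0 \<bullet> e)"
        using real[OF x] by simp
      from sums_diff[OF this sums_single[of 0 "\<lambda>_. fps_nth m 0 \<bullet> e"]]
      have "(\<lambda>n. fps_nth m n \<bullet> e * x ^ n - (if n = 0 then fps_nth m 0 \<bullet> e else 0)) sums 0" by simp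
      moreover have "fps_nth m n \<bullet> e * x ^ n - (if n = 0 then fps_nth m 0 \<bullet> e else 0)
        = (if n = 0 then 0 else fps_nth m n \<bullet> e) * x ^ n" for n by simp
      ultimately show "(\<lambda>n. (if n = 0 then 0 else fps_nth m n \<bullet> e) * x ^ n) sums 0" by simp
    qed
    from this[of "fps_nth m n"] show ?thesis using that by simp
  qed
  then have "m = fps_const (fps_nth m 0)" by (auto simp: fps_eq_iff)
  then show ?thesis using m0 by simp
qed

lemma qcnj_inverse: "qcnj (inverse x) = inverse (qcnj x)"
  by (simp add: inverse_quat_def)

text \<open>
  The resolvent of \<open>b\<close> is \<open>\<beta>\<close> times the resolvent of \<open>q * qcnj \<xi>\<close> plus a constant. Solving for \<open>b\<close> gives a
  linear fractional expression with constants \<open>\<mu> = \<beta> + \<kappa>\<close> and \<open>\<kappa>\<close>; the condition on the real part of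
  \<open>\<kappa>\<close> means \<open>\<mu> - 1 = - qcnj \<kappa>\<close> and \<open>\<kappa> - 1 = - qcnj \<mu>\<close>, which is the symmetry between numerator and
  denominator of a Moebius transformation of the ball.
\<close>
lemma moebius_of_resolvent:
  fixes b :: "quat fps"
  assumes L: "L * (1 - b) = 1" and s: "(1 - fps_X * fps_const (qcnj \<xi>)) * s = 1"
    and eq: "L = s * fps_const (of_real \<beta>) + fps_const \<kappa>"
    and \<xi>: "norm \<xi> = 1" and \<beta>: "\<beta> > 0" and \<kappa>: "qre \<kappa> = (1 - \<beta>) / 2"
  shows "\<exists>u v. norm u < 1 \<and> norm v = 1 \<and> (1 - fps_X * fps_const (qcnj u)) * b = (fps_X - fps_const u) * fps_const v"
proof -
  define \<mu> where "\<mu> = of_real \<beta> + \<kappa>"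
  have re: "qre \<mu> = (1 + \<beta>) / 2" by (simp add: \<mu>_def \<kappa> field_simps)
  have mu0: "\<mu> \<noteq> 0" using re \<beta> by auto
  have mu1: "\<mu> - 1 = - qcnj \<kappa>" "\<kappa> - 1 = - qcnj \<mu>"
    using \<kappa> re by (simp_all add: quat_eq_iff \<mu>_def field_simps)
  define u where "u = qcnj \<kappa> * \<xi> * inverse (qcnj \<mu>)"
  define v where "v = inverse \<mu> * qcnj \<xi> * qcnj \<mu>"
  let ?K = fps_const
  let ?T = "1 - fps_X * ?K (qcnj \<xi>)"
  have "?T * L = (?T * s) * ?K (of_real \<beta>) + ?T * ?K \<kappa>"
    unfolding eq by (simp only: distrib_left mult.assoc)
  also have "\<dots> = ?K \<mu> - fps_X * ?K (qcnj \<xi> * \<kappa>)"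
    unfolding s \<mu>_def
    by (simp only: left_diff_distrib mult_1_left mult.assoc fps_const_mult fps_const_add[symmetric] add_diff_eq)
  finally have TL: "?T * L = ?K \<mu> - fps_X * ?K (qcnj \<xi> * \<kappa>)" .
  have "?T = ?T * L * (1 - b)" using L by (simp add: mult.assoc)
  then have T: "?T = (?K \<mu> - fps_X * ?K (qcnj \<xi> * \<kappa>)) * (1 - b)" unfolding TL .
  then have "(?K \<mu> - fps_X * ?K (qcnj \<xi> * \<kappa>)) * b = (?K \<mu> - fps_X * ?K (qcnj \<xi> * \<kappa>)) - ?T"
    by (simp add: right_diff_distrib)
  also have "\<dots> = ?K (\<mu> - 1) - fps_X * ?K (qcnj \<xi> * (\<kappa> - 1))"
    by (simp only: right_diff_distrib mult_1_right fps_const_1_eq_1 fps_const_sub[symmetric]) (simp only: algebra_simps)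
  also have "\<dots> = fps_X * ?K (qcnj \<xi> * qcnj \<mu>) - ?K (qcnj \<kappa>)"
    unfolding mu1 by (simp only: mult_minus_right fps_const_neg[symmetric] diff_minus_eq_add uminus_add_conv_diff)
  finally have b: "(?K \<mu> - fps_X * ?K (qcnj \<xi> * \<kappa>)) * b = fps_X * ?K (qcnj \<xi> * qcnj \<mu>) - ?K (qcnj \<kappa>)" .
  have X: "?K c * (fps_X * ?K d) = fps_X * ?K (c * d)" for c d :: quat
    by (simp only: mult.assoc[symmetric] fps_mult_fps_X_commute) (simp only: mult.assoc fps_mult_fps_X_commute fps_const_mult)
  have cu: "qcnj u = inverse \<mu> * (qcnj \<xi> * \<kappa>)"
    by (simp add: u_def qcnj_inverse mult.assoc)
  have uv: "u * v = inverse \<mu> * qcnj \<kappa>"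
  proof -
    have inv: "inverse \<mu> = inverse ((norm \<mu>)\<^sup>2) *\<^sub>R qcnj \<mu>" "inverse (qcnj \<mu>) = inverse ((norm \<mu>)\<^sup>2) *\<^sub>R \<mu>"
      by (simp_all add: inverse_quat_def)
    have mm: "\<mu> * (qcnj \<mu> * x) = (norm \<mu>)\<^sup>2 *\<^sub>R x" for x
      by (simp only: mult.assoc[symmetric] mult_qcnj scaleR_conv_of_real)
    have xx: "\<xi> * (qcnj \<xi> * x) = x" for x
      using \<xi> by (simp only: mult.assoc[symmetric] mult_qcnj) simp
    have comm: "qcnj \<kappa> * qcnj \<mu> = qcnj \<mu> * qcnj \<kappa>"
      by (simp add: \<mu>_def distrib_left distrib_right of_real_commute)
    show ?thesis
      using mu0 by (simp add: u_def v_def inv mult.assoc mm xx comm)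
  qed
  have "(1 - fps_X * ?K (qcnj u)) * b = ?K (inverse \<mu>) * ((?K \<mu> - fps_X * ?K (qcnj \<xi> * \<kappa>)) * b)"
    unfolding mult.assoc[symmetric] using mu0 by (simp only: cu X right_diff_distrib fps_const_mult left_inverse fps_const_1_eq_1 mult_1_left simp_thms)
  also have "\<dots> = (fps_X - ?K u) * ?K v"
    unfolding b by (simp only: X right_diff_distrib left_diff_distrib uv fps_const_mult) (simp only: v_def mult.assoc)
  finally have main: "(1 - fps_X * ?K (qcnj u)) * b = (fps_X - ?K u) * ?K v" .
  have "(norm \<kappa>)\<^sup>2 < (norm \<mu>)\<^sup>2"
  proof -
    have "(norm \<mu>)\<^sup>2 - (norm \<kappa>)\<^sup>2 = (qre \<mu>)\<^sup>2 - (qre \<kappa>)\<^sup>2"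
      unfolding norm_quat_power2 by (simp add: \<mu>_def)
    also have "\<dots> = \<beta>" unfolding re \<kappa> by (simp add: power2_eq_square field_simps)
    finally show ?thesis using \<beta> by simp
  qed
  then have "norm \<kappa> < norm \<mu>" by (simp add: power_less_imp_less_base)
  moreover have "norm u = norm \<kappa> / norm \<mu>"
    using \<xi> by (simp add: u_def norm_mult norm_inverse norm_divide divide_inverse)
  ultimately have "norm u < 1"
    using mu0 by simp
  moreover have "norm v = 1" using mu0 \<xi> by (simp add: v_def norm_mult norm_inverse)
  ultimately show ?thesis using main by blast
qed

text \<open>
  The slice regular counterpart of
  \<open>1 - (norm y)\<^sup>2 = (1 - (norm q)\<^sup>2) * (1 - (norm u)\<^sup>2) / (norm (1 - q * qcnj u))\<^sup>2\<close> for a disc automorphism \<open>y\<close>,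
  expressed through the value \<open>y\<close> instead of the point \<open>q\<close>.
\<close>
lemma moebius_norm_identity:
  fixes y u q :: quat
  assumes "y + u = q * (1 + y * qcnj u)"
  shows "(1 - (norm q)\<^sup>2) * (norm (1 + y * qcnj u))\<^sup>2 = (1 - (norm y)\<^sup>2) * (1 - (norm u)\<^sup>2)"
proof -
  have "(norm (y + u))\<^sup>2 = (norm q)\<^sup>2 * (norm (1 + y * qcnj u))\<^sup>2"
    unfolding assms by (simp add: norm_mult power_mult_distrib)
  moreover have "(norm (1 + y * qcnj u))\<^sup>2 - (norm (y + u))\<^sup>2 = (1 - (norm y)\<^sup>2) * (1 - (norm u)\<^sup>2)"
  proof -
    have "qre (y * qcnj u) = qre (qcnj y * u)" by simp
    moreover have "(norm (1 + w))\<^sup>2 = 1 + (norm w)\<^sup>2 + 2 * qre w" for w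
      using norm_add_sq[of 1 w] by simp
    ultimately show ?thesis
      unfolding norm_add_sq[of y u] by (simp only: norm_mult norm_qcnj power_mult_distrib) (simp only: algebra_simps)
  qed
  ultimately show ?thesis by (simp add: left_diff_distrib)
qed

text \<open>
  The factors \<open>fps_X - u\<close> and \<open>1 - fps_X * qcnj u\<close> commute, so the reciprocal may be moved to the
  right. In that order the constant \<open>qcnj u\<close> multiplies from the right, and evaluation at a
  point respects the equation.
\<close>
lemma moebius_equation:
  assumes a: "ball_convergent a" and u: "norm u < 1" and v: "norm v = 1"
    and eq: "(1 - fps_X * fps_const (qcnj u)) * a = (fps_X - fps_const u) * fps_const v"
    and q: "norm q < 1"
  shows "peval a q * qcnj v + u = q * (1 + peval a q * qcnj v * qcnj u)"
proof -
  let ?c = "fps_X * fps_const (qcnj u)" and ?N = "a * fps_const (qcnj v)"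
  note c = ball_self_map_linear(1)[OF less_imp_le[OF u]]
  let ?R = "inverse (1 - ?c)"
  have "v * qcnj v = 1" using v by (simp only: mult_qcnj) simp
  then have *: "(1 - ?c) * ?N = fps_X - fps_const u"
    by (simp only: mult.assoc[symmetric] eq) (simp only: mult.assoc fps_const_mult fps_const_1_eq_1 mult_1_right)
  have N: "?N = ?R * (fps_X - fps_const u)"
    unfolding *[symmetric] mult.assoc[symmetric, of ?R] inverse_one_minus(1)[OF c] by (rule mult_1_left[symmetric])
  have comm: "(fps_X - fps_const u) * (1 - ?c) = (1 - ?c) * (fps_X - fps_const u)"
  proof -
    have "fps_const u * fps_const (qcnj u) = fps_const (qcnj u) * fps_const u"
      by (simp only: fps_const_mult mult_qcnj)
    then have 1: "fps_const u * ?c = ?c * fps_const u"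
      unfolding mult.assoc by (simp only: mult.assoc[symmetric] fps_mult_fps_X_commute[symmetric, of "fps_const u"])
        (simp only: mult.assoc)
    have 2: "?c * fps_X = fps_X * ?c"
      by (rule fps_mult_fps_X_commute[symmetric])
    show ?thesis
      by (simp only: left_diff_distrib right_diff_distrib mult_1_left mult_1_right 1 2) (simp only: algebra_simps)
  qed
  have "?N * (1 - ?c) = fps_X - fps_const u"
    unfolding N mult.assoc comm by (simp only: mult.assoc[symmetric] inverse_one_minus(1)[OF c] mult_1_left)
  then have "?N = fps_X - fps_const u + ?N * ?c" by (simp add: right_diff_distrib diff_eq_eq)
  also have "?N * ?c = (fps_X * ?N) * fps_const (qcnj u)"
    by (simp only: fps_mult_fps_X_commute[of ?N] mult.assoc[symmetric, of ?N])
  finally have "peval ?N q = peval (fps_X - fps_const u + (fps_X * ?N) * fps_const (qcnj u)) q"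
    by (rule arg_cong)
  also have "\<dots> = q - u + q * peval ?N q * qcnj u"
    using a q by (simp add: peval_add peval_diff peval_mult_const[of "fps_X * ?N"] peval_X_mult ball_convergent_diff
        ball_convergent_mult_const ball_convergent_mult)
  finally show ?thesis using a q by (simp add: peval_mult_const algebra_simps)
qed

section \<open>The Julia inequality\<close>

lemma szego_0 [simp]: "norm p \<le> 1 \<Longrightarrow> szego 0 p X = X"
  using szego_rec[of 0 p X] by simp

lemma constant_factor_sums:
  assumes "ball_self_map b" "norm q < 1"
  shows "(\<lambda>k. q ^ k * 1 * fps_nth b k) sums peval b q"
  using assms peval_sums[of b q] by (simp add: ball_self_map_def)

text \<open>
  The boundary inequality at \<open>q = 0\<close> with \<open>A = 1\<close>: its left-hand side \<open>(norm (1 - b(0)))\<^sup>2\<close> does not vanish.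
\<close>
lemma julia_coefficient_pos:
  assumes b: "ball_self_map b"
    and p: "\<And>n. norm (p n) < 1" "p \<longlonglongrightarrow> \<xi>" "norm \<xi> = 1" and lim: "(\<lambda>n. peval b (p n)) \<longlonglongrightarrow> 1"
    and \<alpha>: "(\<lambda>n. (1 - (norm (peval b (p n)))\<^sup>2) / (1 - (norm (p n))\<^sup>2)) \<longlonglongrightarrow> \<alpha>"
  shows "\<alpha> > 0"
proof -
  have F: "norm (peval b 0) < 1" using b by (simp add: ball_self_map_def)
  have "(norm (szego 0 \<xi> (1 - peval b 0)))\<^sup>2 * (1 - (norm (0::quat))\<^sup>2) \<le> \<alpha> * ((norm (1::quat))\<^sup>2 - (norm (peval b 0))\<^sup>2)"
    by (rule boundary_inequality[OF b _ constant_factor_sums[OF b] p lim \<alpha>]) simp_all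
  then have "(norm (1 - peval b 0))\<^sup>2 \<le> \<alpha> * (1 - (norm (peval b 0))\<^sup>2)" using p(3) by simp
  moreover have "(norm (1 - peval b 0))\<^sup>2 > 0" using F by auto
  moreover have "1 - (norm (peval b 0))\<^sup>2 > 0" using F by (simp add: power_less_one_iff)
  ultimately show ?thesis by (metis less_le_trans zero_less_mult_pos2)
qed

text \<open>
  The boundary inequality with \<open>A\<close> the value of the resolvent at \<open>q\<close>.
\<close>
lemma julia_inequality:
  assumes b: "ball_self_map b" and F: "\<And>q. q \<in> ball 0 1 \<Longrightarrow> F q = peval b q"
    and p: "\<And>n. norm (p n) < 1" "p \<longlonglongrightarrow> \<xi>" "norm \<xi> = 1" and lim: "(\<lambda>n. peval b (p n)) \<longlonglongrightarrow> 1"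
    and \<alpha>: "(\<lambda>n. (1 - (norm (peval b (p n)))\<^sup>2) / (1 - (norm (p n))\<^sup>2)) \<longlonglongrightarrow> \<alpha>"
    and q: "q \<in> ball 0 1"
  shows "1 / \<alpha> * qre (regular_cayley (\<lambda>q. q * qcnj \<xi>) q) \<le> qre (regular_cayley F q)"
proof -
  have q': "norm q < 1" using q by simp
  let ?L = "peval (inverse (1 - b)) q"
  have "(norm (szego q \<xi> (?L - (?L - 1))))\<^sup>2 * (1 - (norm q)\<^sup>2) \<le> \<alpha> * ((norm ?L)\<^sup>2 - (norm (?L - 1))\<^sup>2)"
    by (rule boundary_inequality[OF b q' resolvent_sums[OF b q'] p lim \<alpha>])
  moreover have "qre (regular_cayley F q) = (norm ?L)\<^sup>2 - (norm (?L - 1))\<^sup>2"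
    by (simp only: regular_cayley_eq[OF b F q] qre_two_minus_one)
  ultimately have "qre (regular_cayley (\<lambda>q. q * qcnj \<xi>) q) \<le> \<alpha> * qre (regular_cayley F q)"
    using qre_cayley_rotation[OF p(3) q'] by (simp add: mult.commute)
  then show ?thesis
    using julia_coefficient_pos[OF b p lim \<alpha>] by (simp add: divide_le_eq mult.commute)
qed

text \<open>
  The difference of the two sides of the Julia inequality is the real part of the power series \<open>m\<close>. If it
  vanishes somewhere, \<open>m\<close> is an imaginary constant, so the resolvents of \<open>b\<close> and of \<open>q * qcnj \<xi>\<close>
  satisfy the affine relation solved in \<open>moebius_of_resolvent\<close>.
\<close>
lemma julia_equality_moebius:
  assumes b: "ball_self_map b" and F: "\<And>q. q \<in> ball 0 1 \<Longrightarrow> F q = peval b q"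
    and p: "\<And>n. norm (p n) < 1" "p \<longlonglongrightarrow> \<xi>" "norm \<xi> = 1" and lim: "(\<lambda>n. peval b (p n)) \<longlonglongrightarrow> 1"
    and \<alpha>: "(\<lambda>n. (1 - (norm (peval b (p n)))\<^sup>2) / (1 - (norm (p n))\<^sup>2)) \<longlonglongrightarrow> \<alpha>"
    and q0: "q0 \<in> ball 0 1" "qre (regular_cayley F q0) \<le> 1 / \<alpha> * qre (regular_cayley (\<lambda>q. q * qcnj \<xi>) q0)"
  shows "\<exists>u v. norm u < 1 \<and> norm v = 1 \<and>
    (1 - fps_X * fps_const (qcnj u)) * b = (fps_X - fps_const u) * fps_const v"
proof -
  let ?L = "inverse (1 - b)" and ?c = "fps_X * fps_const (qcnj \<xi>)"
  let ?s = "inverse (1 - ?c)" and ?\<beta> = "1 / \<alpha>"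
  note c = ball_self_map_linear[OF eq_refl[OF p(3)]]
  have conv: "ball_convergent ?L" "ball_convergent ?s"
    using b c by (auto intro: ball_convergent_inverse_one_minus)
  define m where "m = (?L + ?L - 1) - (?s + ?s - 1) * fps_const (of_real ?\<beta>)"
  have convm: "ball_convergent m"
    unfolding m_def using conv by (intro ball_convergent_diff ball_convergent_add ball_convergent_mult_const) auto
  have m: "qre (peval m q) = qre (regular_cayley F q) - ?\<beta> * qre (regular_cayley (\<lambda>q. q * qcnj \<xi>) q)"
    if q: "q \<in> ball 0 1" for q
  proof -
    have q': "norm q < 1" using q by simp
    have double: "peval (l + l - 1) q = 2 * peval l q - 1" if "ball_convergent l" for l
      using that q' by (simp add: peval_diff peval_add ball_convergent_add mult_2)
    have "regular_cayley F q = 2 * peval ?L q - 1"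
      by (rule regular_cayley_eq[OF b F q])
    then have "regular_cayley F q = peval (?L + ?L - 1) q"
      by (simp only: double[OF conv(1)])
    moreover have "regular_cayley (\<lambda>q. q * qcnj \<xi>) q = 2 * peval ?s q - 1"
      by (rule regular_cayley_eq[OF c(1) _ q]) (simp add: c(2))
    then have "regular_cayley (\<lambda>q. q * qcnj \<xi>) q = peval (?s + ?s - 1) q"
      by (simp only: double[OF conv(2)])
    moreover have "peval m q = peval (?L + ?L - 1) q - ?\<beta> *\<^sub>R peval (?s + ?s - 1) q"
    proof -
      have "ball_convergent (?L + ?L - 1)" "ball_convergent (?s + ?s - 1)"
        by (intro ball_convergent_diff ball_convergent_add conv ball_convergent_1)+
      then have "peval m q = peval (?L + ?L - 1) q - peval (?s + ?s - 1) q * of_real ?\<beta>"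
        unfolding m_def using q' by (simp only: peval_diff[of "?L + ?L - 1"] peval_mult_const ball_convergent_mult_const)
      then show ?thesis by (simp only: scaleR_conv_of_real of_real_commute)
    qed
    ultimately show ?thesis by simp
  qed
  have const: "m = fps_const (fps_nth m 0) \<and> qre (fps_nth m 0) = 0"
  proof (rule qre_nonneg_zero_constant[OF convm _ q0(1)])
    show "0 \<le> qre (peval m q)" if "q \<in> ball 0 1" for q
      using julia_inequality[OF b F p lim \<alpha> that] m[OF that] by simp
    show "qre (peval m q0) = 0"
      using julia_inequality[OF b F p lim \<alpha> q0(1)] m[OF q0(1)] q0(2) by simp
  qed
  define \<kappa> where "\<kappa> = of_real ((1 - ?\<beta>) / 2) + (1 / 2) *\<^sub>R fps_nth m 0"
  have "?L = ?s * fps_const (of_real ?\<beta>) + fps_const \<kappa>"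
  proof (rule fps_ext)
    fix n
    have \<beta>: "x * of_real ?\<beta> = ?\<beta> *\<^sub>R x" for x :: quat
      by (simp only: scaleR_conv_of_real of_real_commute)
    have "fps_nth m n = 2 *\<^sub>R fps_nth ?L n - fps_nth 1 n - ?\<beta> *\<^sub>R (2 *\<^sub>R fps_nth ?s n - fps_nth 1 n)"
      unfolding m_def by (simp only: fps_sub_nth fps_add_nth fps_mult_right_const_nth \<beta> scaleR_2)
    moreover have "fps_nth m n = (if n = 0 then fps_nth m 0 else 0)"
      using const by (metis fps_nth_fps_const)
    ultimately have *: "2 *\<^sub>R fps_nth ?L n = (if n = 0 then fps_nth m 0 else 0) + fps_nth 1 n
        + ?\<beta> *\<^sub>R (2 *\<^sub>R fps_nth ?s n - fps_nth 1 n)" by simp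
    have "2 *\<^sub>R fps_nth (?s * fps_const (of_real ?\<beta>) + fps_const \<kappa>) n = 
        2 *\<^sub>R (?\<beta> *\<^sub>R fps_nth ?s n) + (if n = 0 then 2 *\<^sub>R \<kappa> else 0)"
      by (simp only: fps_add_nth fps_mult_right_const_nth \<beta> fps_nth_fps_const scaleR_add_right) simp
    also have "\<dots> = 2 *\<^sub>R fps_nth ?L n"
      unfolding * by (simp add: \<kappa>_def of_real_def scaleR_add_right scaleR_diff_right scaleR_diff_left diff_divide_distrib)
    finally show "fps_nth ?L n = fps_nth (?s * fps_const (of_real ?\<beta>) + fps_const \<kappa>) n" by simp
  qed
  then show ?thesis
  proof (rule moebius_of_resolvent[OF inverse_one_minus(1)[OF b] inverse_one_minus(2)[OF c(1)]])
    show "qre \<kappa> = (1 - ?\<beta>) / 2" using const unfolding \<kappa>_def quat_ring_sel quat_scaleR_sel qre_simps by simp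
    show "?\<beta> > 0" using julia_coefficient_pos[OF b p lim \<alpha>] by simp
  qed (rule p(3))
qed

text \<open>
  For a Moebius transformation the defect quotient extends continuously to the boundary, so \<open>\<alpha>\<close> has an
  explicit value, and that value is the one that gives equality in the Julia inequality at \<open>q = 0\<close>.
\<close>
lemma moebius_julia_coefficient:
  assumes a: "ball_convergent a" and u: "norm u < 1" and v: "norm v = 1" and \<eta>: "norm \<eta> = 1"
    and eq: "(1 - fps_X * fps_const (qcnj u)) * a = (fps_X - fps_const u) * fps_const v"
    and p: "\<And>n. norm (p n) < 1" and lim: "(\<lambda>n. peval a (p n)) \<longlonglongrightarrow> \<eta>"
    and \<alpha>: "(\<lambda>n. (1 - (norm (peval a (p n)))\<^sup>2) / (1 - (norm (p n))\<^sup>2)) \<longlonglongrightarrow> \<alpha>"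
  shows "\<alpha> * (1 - (norm (peval a 0))\<^sup>2) = (norm (1 - peval a 0 * qcnj \<eta>))\<^sup>2"
proof -
  have u2: "1 - (norm u)\<^sup>2 > 0" using u by (simp add: power_less_one_iff)
  have ratio: "(1 - (norm (peval a (p n)))\<^sup>2) / (1 - (norm (p n))\<^sup>2)
      = (norm (1 + peval a (p n) * qcnj v * qcnj u))\<^sup>2 / (1 - (norm u)\<^sup>2)" for n
  proof -
    have "(1 - (norm (p n))\<^sup>2) * (norm (1 + peval a (p n) * qcnj v * qcnj u))\<^sup>2
        = (1 - (norm (peval a (p n)))\<^sup>2) * (1 - (norm u)\<^sup>2)"
      using moebius_norm_identity[OF moebius_equation[OF a u v eq p]] v by (simp add: norm_mult)
    moreover have "1 - (norm (p n))\<^sup>2 > 0" using p[of n] by (simp add: power_less_one_iff)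
    ultimately show ?thesis using u2 by (simp add: frac_eq_eq mult.commute)
  qed
  have "(\<lambda>n. (norm (1 + peval a (p n) * qcnj v * qcnj u))\<^sup>2 / (1 - (norm u)\<^sup>2)) \<longlonglongrightarrow>
      (norm (1 + \<eta> * qcnj v * qcnj u))\<^sup>2 / (1 - (norm u)\<^sup>2)"
    using u2 by (intro tendsto_intros lim) simp
  then have \<alpha>': "\<alpha> = (norm (1 + \<eta> * qcnj v * qcnj u))\<^sup>2 / (1 - (norm u)\<^sup>2)"
    using LIMSEQ_unique[OF \<alpha>] by (simp add: ratio)
  have "peval a 0 * qcnj v + u = 0"
    using moebius_equation[OF a u v eq, of 0] by simp
  then have "peval a 0 * qcnj v = - u" by (simp add: eq_neg_iff_add_eq_0)
  then have "peval a 0 * (qcnj v * v) = - (u * v)" by (metis mult.assoc mult_minus_left)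
  moreover have "qcnj v * v = 1" using v by (simp only: mult_qcnj) simp
  ultimately have a0: "peval a 0 = - (u * v)" by simp
  have "1 - peval a 0 * qcnj \<eta> = qcnj (1 + \<eta> * qcnj v * qcnj u)"
    by (simp add: a0 mult.assoc)
  then have "norm (1 - peval a 0 * qcnj \<eta>) = norm (1 + \<eta> * qcnj v * qcnj u)"
    by (metis norm_qcnj)
  moreover have "norm (peval a 0) = norm u" using v by (simp add: a0 norm_mult)
  ultimately show ?thesis using u2 by (simp add: \<alpha>')
qed

lemma qre_cayley_at_0:
  assumes b: "ball_self_map b" and F: "\<And>q. q \<in> ball 0 1 \<Longrightarrow> F q = peval b q"
  shows "qre (regular_cayley F 0) * (norm (1 - peval b 0))\<^sup>2 = 1 - (norm (peval b 0))\<^sup>2"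
proof -
  let ?l = "fps_nth (inverse (1 - b)) 0"
  have "?l * (1 - fps_nth b 0) = 1"
    using arg_cong[OF inverse_one_minus(1)[OF b], of "\<lambda>x. fps_nth x 0"] by (simp add: fps_mult_nth)
  then have l: "?l * (1 - peval b 0) = 1" by (simp add: peval_0)
  have "?l - 1 = ?l - ?l * (1 - peval b 0)" by (simp only: l)
  also have "\<dots> = ?l * peval b 0" by (simp add: right_diff_distrib)
  finally have "qre (regular_cayley F 0) = (norm ?l)\<^sup>2 * (1 - (norm (peval b 0))\<^sup>2)"
    by (simp only: regular_cayley_eq[OF b F centre_in_ball[THEN iffD2, OF zero_less_one]] qre_two_minus_one peval_0)
       (simp add: norm_mult power_mult_distrib right_diff_distrib)
  moreover have "norm ?l * norm (1 - peval b 0) = 1" by (metis l norm_mult norm_one)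
  then have "(norm ?l)\<^sup>2 * (norm (1 - peval b 0))\<^sup>2 = 1" by (simp flip: power_mult_distrib)
  ultimately show ?thesis by (simp add: mult.commute mult.left_commute)
qed

text \<open>
  The boundary inequality with \<open>A = 1\<close>, where \<open>E\<close> is the value of \<open>b\<close> at \<open>q\<close>. For the real boundary point
  1 the kernel has the closed form \<open>szego q 1 X = inverse (1 - q) * X\<close>; it is this step that ties
  the Euclidean inequality to \<open>\<xi> = 1\<close>.
\<close>
lemma julia_horoball_inequality:
  assumes b: "ball_self_map b"
    and p: "\<And>n. norm (p n) < 1" "p \<longlonglongrightarrow> 1" and lim: "(\<lambda>n. peval b (p n)) \<longlonglongrightarrow> 1"
    and \<alpha>: "(\<lambda>n. (1 - (norm (peval b (p n)))\<^sup>2) / (1 - (norm (p n))\<^sup>2)) \<longlonglongrightarrow> \<alpha>"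
    and q: "norm q < 1"
  shows "(norm (1 - peval b q))\<^sup>2 / (1 - (norm (peval b q))\<^sup>2) \<le> \<alpha> * ((norm (1 - q))\<^sup>2 / (1 - (norm q)\<^sup>2))"
proof -
  let ?Z = "szego q 1 (1 - peval b q)"
  have "?Z = (1 - peval b q) + q * ?Z * qcnj 1" using q by (intro szego_rec) auto
  then have "(1 - q) * ?Z = 1 - peval b q" by (simp add: left_diff_distrib diff_eq_eq)
  then have Z: "(norm (1 - peval b q))\<^sup>2 = (norm (1 - q))\<^sup>2 * (norm ?Z)\<^sup>2"
    by (metis norm_mult power_mult_distrib)
  have "(norm ?Z)\<^sup>2 * (1 - (norm q)\<^sup>2) \<le> \<alpha> * ((norm (1::quat))\<^sup>2 - (norm (peval b q))\<^sup>2)"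
    by (rule boundary_inequality[OF b q constant_factor_sums[OF b q] p _ lim \<alpha>]) simp
  then have "(norm (1 - q))\<^sup>2 * ((norm ?Z)\<^sup>2 * (1 - (norm q)\<^sup>2)) \<le> (norm (1 - q))\<^sup>2 * (\<alpha> * (1 - (norm (peval b q))\<^sup>2))"
    by (intro mult_left_mono) auto
  then have "(norm (1 - peval b q))\<^sup>2 * (1 - (norm q)\<^sup>2) \<le> \<alpha> * (norm (1 - q))\<^sup>2 * (1 - (norm (peval b q))\<^sup>2)"
    by (simp add: Z mult_ac)
  moreover have "1 - (norm q)\<^sup>2 > 0" "1 - (norm (peval b q))\<^sup>2 > 0"
    using q b by (auto simp: ball_self_map_def power_less_one_iff)
  ultimately show ?thesis by (simp add: field_simps)
qed

lemma horoball_image_subset: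
  assumes maps: "f ` ball 0 1 \<subseteq> ball 0 1" and \<alpha>: "\<alpha> > 0"
    and ineq: "\<forall>q\<in>ball 0 1. (norm (\<eta> - f q))\<^sup>2 / (1 - (norm (f q))\<^sup>2) \<le> \<alpha> * ((norm (p - q))\<^sup>2 / (1 - (norm q)\<^sup>2))"
  shows "f ` horoball p k \<subseteq> horoball \<eta> (\<alpha> * k)"
proof safe
  fix q assume "q \<in> horoball p k"
  then have q: "q \<in> ball 0 1" and lt: "(norm (p - q))\<^sup>2 < k * (1 - (norm q)\<^sup>2)" by (auto simp: horoball_def)
  have fq: "f q \<in> ball 0 1" using maps q by blast
  then have pos: "1 - (norm q)\<^sup>2 > 0" "1 - (norm (f q))\<^sup>2 > 0" using q by (auto simp: power_less_one_iff)
  have "(norm (\<eta> - f q))\<^sup>2 / (1 - (norm (f q))\<^sup>2) \<le> \<alpha> * ((norm (p - q))\<^sup>2 / (1 - (norm q)\<^sup>2))" using ineq q by blast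
  also have "\<dots> < \<alpha> * k" using lt pos \<alpha> by (simp add: pos_divide_less_eq)
  finally show "f q \<in> horoball \<eta> (\<alpha> * k)" using fq pos by (simp add: horoball_def pos_divide_less_eq)
qed

theorem theorem1:
  fixes f :: "quat \<Rightarrow> quat" and \<xi> \<eta> :: quat and \<alpha> :: real and qs :: "nat \<Rightarrow> quat"
  assumes "slice_regular_on (ball 0 1) f" and "f ` ball 0 1 \<subseteq> ball 0 1"
    and "\<xi> \<in> sphere 0 1"
    and "\<And>n. qs n \<in> ball 0 1" and "qs \<longlonglongrightarrow> \<xi>"
    and "(\<lambda>n. (1 - norm (f (qs n))) / (1 - norm (qs n))) \<longlonglongrightarrow> \<alpha>"
    and "(\<lambda>n. f (qs n)) \<longlonglongrightarrow> \<eta>"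
  shows "\<alpha> > 0 \<and>
    (\<forall>q\<in>ball 0 1. qre (regular_cayley (\<lambda>q. f q * qcnj \<eta>) q)
        \<ge> 1 / \<alpha> * qre (regular_cayley (\<lambda>q. q * qcnj \<xi>) q)) \<and>
    ((\<forall>q\<in>ball 0 1. qre (regular_cayley (\<lambda>q. f q * qcnj \<eta>) q)
        > 1 / \<alpha> * qre (regular_cayley (\<lambda>q. q * qcnj \<xi>) q)) \<longleftrightarrow> \<not> regular_moebius f) \<and>
    (\<xi> = 1 \<longrightarrow>
      ((\<forall>q\<in>ball 0 1. qre (regular_cayley (\<lambda>q. f q * qcnj \<eta>) q)
          \<ge> 1 / \<alpha> * qre (regular_cayley (\<lambda>q. q * qcnj \<xi>) q)) \<longleftrightarrow>
        (\<forall>q\<in>ball 0 1. (norm (\<eta> - f q))\<^sup>2 / (1 - (norm (f q))\<^sup>2)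
          \<le> \<alpha> * ((norm (1 - q))\<^sup>2 / (1 - (norm q)\<^sup>2)))) \<and>
      ((\<forall>q\<in>ball 0 1. (norm (\<eta> - f q))\<^sup>2 / (1 - (norm (f q))\<^sup>2)
          \<le> \<alpha> * ((norm (1 - q))\<^sup>2 / (1 - (norm q)\<^sup>2))) \<longleftrightarrow>
        (\<forall>k>0. f ` horoball 1 k \<subseteq> horoball \<eta> (\<alpha> * k))) \<and>
      (\<forall>k>0. f ` horoball 1 k \<subseteq> horoball \<eta> (\<alpha> * k)))"
proof -
  obtain a where a: "ball_convergent a" and fa: "\<And>q. q \<in> ball 0 1 \<Longrightarrow> f q = peval a q"
    using slice_regular_expansion[OF assms(1)] by blast
  have fball: "norm (f q) < 1" if "norm q < 1" for q using assms(2) that by force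
  have \<xi>: "norm \<xi> = 1" using assms(3) by simp
  have qs: "norm (qs n) < 1" for n using assms(4)[of n] by simp
  have nqs: "(\<lambda>n. norm (qs n)) \<longlonglongrightarrow> 1" using tendsto_norm[OF assms(5)] \<xi> by simp
  \<comment> \<open>A finite \<open>\<alpha>\<close> forces \<open>\<eta>\<close> onto the unit sphere.\<close>
  have nfq: "(\<lambda>n. norm (f (qs n))) \<longlonglongrightarrow> 1"
  proof -
    have "(\<lambda>n. 1 - (1 - norm (f (qs n))) / (1 - norm (qs n)) * (1 - norm (qs n))) \<longlonglongrightarrow> 1 - \<alpha> * (1 - 1)"
      by (intro tendsto_intros assms(6) nqs)
    moreover have "1 - (1 - norm (f (qs n))) / (1 - norm (qs n)) * (1 - norm (qs n)) = norm (f (qs n))" for n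
      using qs[of n] by simp
    ultimately show ?thesis by simp
  qed
  have \<eta>: "norm \<eta> = 1"
    using LIMSEQ_unique[OF tendsto_norm[OF assms(7)] nfq] .
  have ratio: "(\<lambda>n. (1 - (norm (f (qs n)))\<^sup>2) / (1 - (norm (qs n))\<^sup>2)) \<longlonglongrightarrow> \<alpha>"
  proof -
    have "(\<lambda>n. (1 - norm (f (qs n))) / (1 - norm (qs n)) * ((1 + norm (f (qs n))) / (1 + norm (qs n)))) \<longlonglongrightarrow> \<alpha> * ((1 + 1) / (1 + 1))"
      by (intro tendsto_intros assms(6) nqs nfq) simp
    moreover have "(1 - norm (f (qs n))) / (1 - norm (qs n)) * ((1 + norm (f (qs n))) / (1 + norm (qs n)))
        = (1 - (norm (f (qs n)))\<^sup>2) / (1 - (norm (qs n))\<^sup>2)" for n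
      by (simp add: power2_eq_square algebra_simps)
    ultimately show ?thesis by simp
  qed
  \<comment> \<open>Right multiplication by \<open>qcnj \<eta>\<close> normalizes the boundary value to 1 and leaves all norms unchanged.\<close>
  define b where "b = a * fps_const (qcnj \<eta>)"
  have b: "peval b q = f q * qcnj \<eta>" if "norm q < 1" for q
    using that by (simp add: b_def peval_mult_const[OF a] fa)
  have self: "ball_self_map b"
    unfolding ball_self_map_def
  proof (intro conjI ballI)
    show "ball_convergent b" unfolding b_def by (rule ball_convergent_mult_const[OF a])
    show "norm (peval b q) < 1" if "q \<in> ball 0 1" for q
      using that \<eta> fball by (simp add: b norm_mult)
  qed
  have F: "f q * qcnj \<eta> = peval b q" if "q \<in> ball 0 1" for q using that by (simp add: b)
  have \<eta>\<eta>: "\<eta> * qcnj \<eta> = 1" "qcnj \<eta> * \<eta> = 1" by (simp_all only: mult_qcnj \<eta>) simp_all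
  have lim: "(\<lambda>n. peval b (qs n)) \<longlonglongrightarrow> 1"
    using tendsto_mult[OF assms(7) tendsto_const[of "qcnj \<eta>"]] by (simp only: b[OF qs] \<eta>\<eta>)
  have nb: "norm (peval b q) = norm (f q)" if "norm q < 1" for q using that \<eta> by (simp add: b norm_mult)
  have rb: "(\<lambda>n. (1 - (norm (peval b (qs n)))\<^sup>2) / (1 - (norm (qs n))\<^sup>2)) \<longlonglongrightarrow> \<alpha>"
    using ratio by (simp add: nb[OF qs])
  note hyps = qs assms(5) \<xi> lim rb
  have pos: "\<alpha> > 0" by (rule julia_coefficient_pos[OF self hyps])
  have J: "qre (regular_cayley (\<lambda>q. f q * qcnj \<eta>) q) \<ge> 1 / \<alpha> * qre (regular_cayley (\<lambda>q. q * qcnj \<xi>) q)"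
    if "q \<in> ball 0 1" for q
    by (rule julia_inequality[OF self F hyps that])
  have strict: "(\<forall>q\<in>ball 0 1. qre (regular_cayley (\<lambda>q. f q * qcnj \<eta>) q)
        > 1 / \<alpha> * qre (regular_cayley (\<lambda>q. q * qcnj \<xi>) q)) \<longleftrightarrow> \<not> regular_moebius f"
    (is "?strict \<longleftrightarrow> _")
  proof
    assume ?strict
    show "\<not> regular_moebius f"
    proof
      assume "regular_moebius f"
      then obtain u v where uv: "norm u < 1" "norm v = 1"
        "(1 - fps_X * fps_const (qcnj u)) * a = (fps_X - fps_const u) * fps_const v"
        using regular_moebius_iff[OF a fa] by blast
      \<comment> \<open>equality occurs at the origin\<close>
      have "\<alpha> * (1 - (norm (peval a 0))\<^sup>2) = (norm (1 - peval a 0 * qcnj \<eta>))\<^sup>2"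
        by (rule moebius_julia_coefficient[OF a uv(1,2) \<eta> uv(3) qs])
           (use assms(7) ratio in \<open>simp_all add: fa[OF assms(4)]\<close>)
      then have eq: "\<alpha> * (1 - (norm (peval b 0))\<^sup>2) = (norm (1 - peval b 0))\<^sup>2"
        using b[of 0] nb[of 0] fa[of 0] by simp
      have "qre (regular_cayley (\<lambda>q. f q * qcnj \<eta>) 0) * (\<alpha> * (1 - (norm (peval b 0))\<^sup>2)) = 1 - (norm (peval b 0))\<^sup>2"
        unfolding eq by (rule qre_cayley_at_0[OF self F])
      moreover have "1 - (norm (peval b 0))\<^sup>2 > 0"
        using self by (simp add: ball_self_map_def power_less_one_iff)
      ultimately have "qre (regular_cayley (\<lambda>q. f q * qcnj \<eta>) 0) = 1 / \<alpha>"
        using pos by (simp add: mult.assoc[symmetric] eq_divide_eq)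
      moreover have "qre (regular_cayley (\<lambda>q. q * qcnj \<xi>) 0) = 1"
        using qre_cayley_rotation[OF \<xi>, of 0] \<xi> by simp
      moreover have "qre (regular_cayley (\<lambda>q. f q * qcnj \<eta>) 0) > 1 / \<alpha> * qre (regular_cayley (\<lambda>q. q * qcnj \<xi>) 0)"
        using \<open>?strict\<close> by (rule bspec) simp
      ultimately show False by simp
    qed
  next
    assume not: "\<not> regular_moebius f"
    show ?strict
    proof (rule ccontr)
      assume "\<not> ?strict"
      then obtain q0 where q0: "q0 \<in> ball 0 1"
        "qre (regular_cayley (\<lambda>q. f q * qcnj \<eta>) q0) \<le> 1 / \<alpha> * qre (regular_cayley (\<lambda>q. q * qcnj \<xi>) q0)"
        by (auto simp: not_less)
      obtain u v where uv: "norm u < 1" "norm v = 1"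
        "(1 - fps_X * fps_const (qcnj u)) * b = (fps_X - fps_const u) * fps_const v"
        using julia_equality_moebius[OF self F hyps q0] by blast
      have "b * fps_const \<eta> = a" by (simp add: b_def mult.assoc \<eta>\<eta> del: qcnj_mult)
      then have "(1 - fps_X * fps_const (qcnj u)) * a = (fps_X - fps_const u) * fps_const (v * \<eta>)"
        using uv(3) by (metis mult.assoc fps_const_mult)
      moreover have "norm (v * \<eta>) = 1" using uv \<eta> by (simp add: norm_mult)
      ultimately show False using not uv(1) regular_moebius_iff[OF a fa] by blast
    qed
  qed
  have norm_ineq: "\<forall>q\<in>ball 0 1. (norm (\<eta> - f q))\<^sup>2 / (1 - (norm (f q))\<^sup>2)
          \<le> \<alpha> * ((norm (1 - q))\<^sup>2 / (1 - (norm q)\<^sup>2))" if "\<xi> = 1"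
  proof
    fix q :: quat assume "q \<in> ball 0 1"
    then have q: "norm q < 1" by simp
    have "norm (1 - peval b q) = norm ((\<eta> - f q) * qcnj \<eta>)"
      using q by (simp add: b left_diff_distrib \<eta>\<eta>)
    then have "norm (1 - peval b q) = norm (\<eta> - f q)" using \<eta> by (simp add: norm_mult)
    then show "(norm (\<eta> - f q))\<^sup>2 / (1 - (norm (f q))\<^sup>2) \<le> \<alpha> * ((norm (1 - q))\<^sup>2 / (1 - (norm q)\<^sup>2))"
      using julia_horoball_inequality[OF self qs _ lim rb q] assms(5) that by (simp add: nb[OF q])
  qed
  have horo: "\<forall>k>0. f ` horoball 1 k \<subseteq> horoball \<eta> (\<alpha> * k)" if "\<xi> = 1"
    by (intro allI impI horoball_image_subset[OF assms(2) pos norm_ineq[OF that]])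
  have equiv: "P \<longleftrightarrow> Q" if P and Q for P Q :: bool using that by simp
  show ?thesis
  proof (intro conjI)
    show "\<alpha> > 0" by (rule pos)
    show "\<forall>q\<in>ball 0 1. qre (regular_cayley (\<lambda>q. f q * qcnj \<eta>) q)
        \<ge> 1 / \<alpha> * qre (regular_cayley (\<lambda>q. q * qcnj \<xi>) q)"
      using J by (rule ballI)
  qed (rule strict, rule impI, rule conjI, rule equiv, rule ballI, erule J, erule norm_ineq,
      rule conjI, rule equiv, erule norm_ineq, erule horo, erule horo)
qed

end
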